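(* Let $T>0$, $p\ge 1$, $\gamma>2$, and let $\beta$ be defined by $1/\gamma+1/\beta=1$. Let $$\varphi(t)=\begin{cases}\dfrac{t^2}{\gamma}, & |t|<1,\\[2mm] \dfrac{|t|^\gamma}{\gamma}, & |t|\ge 1.\end{cases}$$ Let $X=\{X(t),t\in[0,T]\}$ be a second-order centered stochastic process belonging to $Sub_\varphi(\Omega)$, with correlation function $B(t,s)=\int_{-\infty}^{\infty} f(t,\lambda)f(s,\lambda)\,d\lambda$, $f(t,\cdot)\in L_2(\mathbb{R})$, and represented as $$X(t)=\sum_{k=0}^\infty a_k(t)\xi_k,\qquad a_k(t)=\int_{-\infty}^\infty f(t,\lambda)\hat H_k(\lambda)\,d\lambda,$$ where $\{\hat H_k\}_{k\ge0}$ are the orthonormal Hermite functions and $\xi_k$ are independent $\varphi$-sub-Gaussian random variables with $E\xi_k=0$, $E\xi_k\xi_l=\delta_{kl}$. Assume that for each $t$ the function $\lambda\mapsto f(t,\lambda)$ is twice differentiable and bounded, and that $\lambda\mapsto Z_f(t,\lambda)$ is integrable on $\mathbb{R}$, where $$Z_f(t,\lambda)=\left|\frac{\partial^2 f(t,\lambda)}{\partial\lambda^2}-\lambda\frac{\partial f(t,\lambda)}{\partial\lambda}+\frac{\lambda^2-2}{4}f(t,\lambda)\right|.$$ Let $X_N(t)=\sum_{k=0}^N \xi_k\hat a_k(t)$ be a model of $X$, where $\hat a_k(t)$ are approximations of $a_k(t)$, and let $\delta_k(t)=|a_k(t)-\hat a_k(t)|$. Suppose $$c_N=\int_0^T\left(\int_{-\infty}^\infty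 Z_f^2(t,\lambda)\,d\lambda\sum_{k=N+1}^\infty\frac{\tau_\varphi^2(\xi_k)}{k^2+3k+2}+\sum_{k=0}^N\tau_\varphi^2(\xi_k)\delta_k^2(t)\right)^{p/2}dt<\infty .$$ Let $\alpha\in(0,1)$ and $\delta>0$. If $$c_N\le\frac{\delta}{\left(\beta\ln\frac{2}{\alpha}\right)^{p/\beta}}\quad\text{and}\quad c_N<\frac{\delta}{p^{\,p(1-1/\gamma)}},$$ then the model $X_N$ approximates the process $X$ with reliability $1-\alpha$ and accuracy $\delta$ in $L_p(0,T)$.
   Context: All processes and functions are real-valued. $\varphi$-sub-Gaussian: a centered random variable $\xi$ belongs to $Sub_\varphi(\Omega)$ if there is $a\ge0$ with $E\exp(\lambda\xi)\le\exp(\varphi(a\lambda))$ for all $\lambda\in\mathbb{R}$; $\tau_\varphi(\xi)$ is the infimum of all such $a$. A process belongs to $Sub_\varphi(\Omega)$ if each $X(t)$ does. Hermite functions: $\hat H_k(\lambda)=\dfrac{H_k(\lambda)}{\sqrt{k!}\,\sqrt[4]{2\pi}}e^{-\lambda^2/4}$, where $H_k(\lambda)=(-1)^k e^{\lambda^2/2}\dfrac{d^k}{d\lambda^k}e^{-\lambda^2/2}$; $\{\hat H_k\}_{k\ge0}$ is an orthonormal basis of $L_2(\mathbb{R})$. Model: the functions $\hat a_k(t)$ are arbitrary (given) approximations of the coefficient functions $a_k(t)$, and the same random variables $\xi_k$ are used in $X$ and in $X_N$. Approximation: $X_N$ approximates $X$ with reliability $1-\alpha$ and accuracy $\delta$ in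 $L_p(0,T)$ if $P\left\{\int_0^T|X(t)-X_N(t)|^p\,dt>\delta\right\}\le\alpha$. *)

theory Defs
  imports "HOL-Probability.Probability"
begin

definition sub_gaussian_bounds :: "'w measure \<Rightarrow> (real \<Rightarrow> real) \<Rightarrow> ('w \<Rightarrow> real) \<Rightarrow> real set" where
  "sub_gaussian_bounds M \<phi> \<xi> =
     {a. 0 \<le> a \<and> (\<forall>u. (\<integral>\<^sup>+\<omega>. ennreal (exp (u * \<xi> \<omega>)) \<partial>M) \<le> ennreal (exp (\<phi> (a * u))))}"

definition centered :: "'w measure \<Rightarrow> ('w \<Rightarrow> real) \<Rightarrow> bool" where
  "centered M \<xi> \<longleftrightarrow> integrable M \<xi> \<and> (\<integral>\<omega>. \<xi> \<omega> \<partial>M) = 0"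

definition Sub :: "'w measure \<Rightarrow> (real \<Rightarrow> real) \<Rightarrow> ('w \<Rightarrow> real) set" where
  "Sub M \<phi> = {\<xi>. centered M \<xi> \<and> sub_gaussian_bounds M \<phi> \<xi> \<noteq> {}}"

(* Only meaningful on Sub M phi, where the infimum is over a nonempty set bounded below by 0. *)
definition sub_norm :: "'w measure \<Rightarrow> (real \<Rightarrow> real) \<Rightarrow> ('w \<Rightarrow> real) \<Rightarrow> real" where
  "sub_norm M \<phi> \<xi> = Inf (sub_gaussian_bounds M \<phi> \<xi>)"

definition phi :: "real \<Rightarrow> real \<Rightarrow> real" where
  "phi \<gamma> t = (if \<bar>t\<bar> < 1 then t\<^sup>2 / \<gamma> else \<bar>t\<bar> powr \<gamma> / \<gamma>)"

definition hermite :: "nat \<Rightarrow> real \<Rightarrow> real" where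
  "hermite k x = (- 1) ^ k * exp (x\<^sup>2 / 2) * (deriv ^^ k) (\<lambda>y. exp (- y\<^sup>2 / 2)) x"

definition hermite_fun :: "nat \<Rightarrow> real \<Rightarrow> real" where
  "hermite_fun k x = hermite k x / (sqrt (fact k) * root 4 (2 * pi)) * exp (- x\<^sup>2 / 4)"

definition coeff_fun :: "(real \<Rightarrow> real \<Rightarrow> real) \<Rightarrow> nat \<Rightarrow> real \<Rightarrow> real" where
  "coeff_fun f k t = (\<integral>x. f t x * hermite_fun k x \<partial>lborel)"

definition Z :: "(real \<Rightarrow> real \<Rightarrow> real) \<Rightarrow> real \<Rightarrow> real \<Rightarrow> real" where
  "Z f t x = \<bar>deriv (deriv (f t)) x - x * deriv (f t) x + (x\<^sup>2 - 2) / 4 * f t x\<bar>"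

definition model :: "(nat \<Rightarrow> 'w \<Rightarrow> real) \<Rightarrow> (nat \<Rightarrow> real \<Rightarrow> real) \<Rightarrow> nat \<Rightarrow> real \<Rightarrow> 'w \<Rightarrow> real" where
  "model \<xi> ahat N t \<omega> = (\<Sum>k\<le>N. \<xi> k \<omega> * ahat k t)"

(* Real powers of extended nonnegative reals, for exponents r > 0. *)
definition epowr :: "ennreal \<Rightarrow> real \<Rightarrow> ennreal" where
  "epowr x r = (if x = \<top> then \<top> else ennreal (enn2real x powr r))"

(* Extended-valued, since neither the square integral of Z nor the tail series need be finite.
   The tail series over k > N is indexed by k = N + 1 + j. *)
definition c_const ::
  "'w measure \<Rightarrow> real \<Rightarrow> real \<Rightarrow> real \<Rightarrow> (real \<Rightarrow> real \<Rightarrow> real) \<Rightarrow> (nat \<Rightarrow> 'w \<Rightarrow> real) \<Rightarrow>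
    (nat \<Rightarrow> real \<Rightarrow> real) \<Rightarrow> nat \<Rightarrow> ennreal" where
  "c_const M T p \<gamma> f \<xi> ahat N =
     (\<integral>\<^sup>+t. epowr
        ((\<integral>\<^sup>+x. ennreal ((Z f t x)\<^sup>2) \<partial>lborel) *
           (\<Sum>j. let k = N + 1 + j in
              ennreal ((sub_norm M (phi \<gamma>) (\<xi> k))\<^sup>2 / ((real k)\<^sup>2 + 3 * real k + 2))) +
         ennreal (\<Sum>k\<le>N. (sub_norm M (phi \<gamma>) (\<xi> k))\<^sup>2 * \<bar>coeff_fun f k t - ahat k t\<bar>\<^sup>2))
        (p / 2) \<partial>lebesgue_on {0..T})"

(* The event is required to be measurable: measure is 0 by convention off the sigma-algebra. *)
definition approximates_Lp ::
  "'w measure \<Rightarrow> real \<Rightarrow> real \<Rightarrow> (real \<Rightarrow> 'w \<Rightarrow> real) \<Rightarrow> (real \<Rightarrow> 'w \<Rightarrow> real) \<Rightarrow> real \<Rightarrow> real \<Rightarrow> bool" where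
  "approximates_Lp M T p X Y \<alpha> \<delta> \<longleftrightarrow>
     (let A = {\<omega> \<in> space M.
        (\<integral>\<^sup>+t. ennreal (\<bar>X t \<omega> - Y t \<omega>\<bar> powr p) \<partial>lebesgue_on {0..T}) > ennreal \<delta>}
      in A \<in> sets M \<and> measure M A \<le> \<alpha>)"

end

theory Submission
  imports Defs "HOL-Real_Asymp.Real_Asymp"
begin

text \<open>
  The error \<open>Y(t) = X(t) - X\<^sub>N(t)\<close> is the sum of a series in the independent variables \<open>\<xi>\<^sub>k\<close> whose
  coefficients \<open>b\<^sub>k(t)\<close> are \<open>a\<^sub>k(t) - a'\<^sub>k(t)\<close> for \<open>k \<le> N\<close> and \<open>a\<^sub>k(t)\<close> for \<open>k > N\<close>, where
  \<open>a'\<^sub>k\<close> approximates \<open>a\<^sub>k\<close>. Three ideas give the result.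

  Size of the coefficients. The weight \<open>e\<^sup>-\<^sup>x\<^sup>2\<^sup>/\<^sup>4\<close> times \<open>f(t, x)\<close> has second derivative
  \<open>\<plusminus>Z\<^sub>f(t, x) e\<^sup>-\<^sup>x\<^sup>2\<^sup>/\<^sup>4\<close>, and Hermite polynomials satisfy \<open>H\<^sub>k\<^sub>+\<^sub>2'' = (k + 1) (k + 2) H\<^sub>k\<close>. Integrating by
  parts twice expresses \<open>a\<^sub>k(t)\<close> through the Hermite coefficient of \<open>\<plusminus>Z\<^sub>f\<close> of index \<open>k + 2\<close>, so that
  \<open>(k\<^sup>2 + 3 k + 2) a\<^sub>k(t)\<^sup>2 \<le> \<integral> Z\<^sub>f\<^sup>2(t, x) dx\<close> (lemma \<open>coeff_fun_square_bound\<close>).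

  Sub-Gaussian norm of the error. Since \<open>\<phi>(t) / t\<^sup>2\<close> is nondecreasing in \<open>|t|\<close>, one has
  \<open>\<Sum> \<phi>(x\<^sub>k) \<le> \<phi>((\<Sum> x\<^sub>k\<^sup>2)\<^sup>1\<^sup>/\<^sup>2)\<close>; hence for independent summands the squared norms add, and Fatou's lemma
  extends this to the series: \<open>E exp (u Y(t)) \<le> exp (\<phi>(u \<sigma>(t)))\<close> with
  \<open>\<sigma>\<^sup>2(t) = \<Sum> \<tau>\<^sup>2(\<xi>\<^sub>k) b\<^sub>k(t)\<^sup>2\<close> (lemma \<open>mgf_le_of_expansion\<close>). By the first step \<open>\<integral> \<sigma>\<^sup>p dt \<le> c\<^sub>N\<close>.

  Tail of the integral. If \<open>c = \<integral> \<sigma>\<^sup>p dt\<close> and \<open>\<delta> = c x\<^sup>p\<close>, the event \<open>\<integral> |Y|\<^sup>p dt > \<delta>\<close> says that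
  \<open>(|Y| / (\<sigma> x))\<^sup>p\<close> has mean above \<open>1\<close> under the probability measure \<open>\<sigma>\<^sup>p dt / c\<close>. A pointwise
  inequality of Bernoulli type passes from this power to \<open>exp (v |Y| / \<sigma> - v x)\<close> whenever \<open>v x \<ge> p\<close>, and
  Markov's inequality yields the bound \<open>2 exp (\<phi>(v) - v x)\<close> on the probability (lemma
  \<open>Lp_tail_bound\<close>). The best \<open>v\<close> turns it into \<open>2 exp (- x\<^sup>\<beta> / \<beta>)\<close>, and the two conditions on
  \<open>c\<^sub>N\<close> ensure \<open>2 exp (- x\<^sup>\<beta> / \<beta>) \<le> \<alpha>\<close> and \<open>v x > p\<close> (lemma \<open>optimal_exponent\<close>).
\<close>

section \<open>Integrals over the real line and a Bessel inequality\<close>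

text \<open>
  Only convergence of \<open>F\<close> along one sequence at each end is asked for, because integrability of
  \<open>F'\<close> already gives \<open>F\<close> limits at both ends. The fundamental theorem of calculus for the
  Henstock-Kurzweil integral is used on the bounded intervals, so \<open>F'\<close> may be discontinuous:
  below it contains a second derivative that merely exists.
\<close>

lemma integral_deriv_eq_0_if_vanishing_ends:
  fixes F F' :: "real \<Rightarrow> real"
  assumes deriv: "\<And>x. (F has_real_derivative F' x) (at x)"
    and int: "integrable lborel F'"
    and l: "\<And>n. l n \<le> - real n" and u: "\<And>n. real n \<le> u n"
    and Fl: "(\<lambda>n. F (l n)) \<longlonglongrightarrow> 0" and Fu: "(\<lambda>n. F (u n)) \<longlonglongrightarrow> 0"
  shows "(\<integral>x. F' x \<partial>lborel) = 0"
proof -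
  have lu: "l n \<le> u n" for n
    using l[of n] u[of n] by linarith
  have part: "(\<integral>x. indicator {l n..u n} x * F' x \<partial>lborel) = F (u n) - F (l n)" for n
  proof -
    have "set_integrable lborel {l n..u n} F'"
      using integrable_mult_indicator[OF _ int, of "{l n..u n}"]
      by (simp add: set_integrable_def)
    from set_borel_integral_eq_integral(2)[OF this]
    have "(LINT x:{l n..u n}|lborel. F' x) = integral {l n..u n} F'" .
    also have "(F' has_integral F (u n) - F (l n)) {l n..u n}"
      using deriv lu
      by (intro fundamental_theorem_of_calculus)
         (auto simp: has_real_derivative_iff_has_vector_derivative[symmetric]
               intro: DERIV_subset)
    hence "integral {l n..u n} F' = F (u n) - F (l n)"
      by (rule integral_unique)
    finally show ?thesis
      by (simp add: set_lebesgue_integral_def)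
  qed
  have "(\<lambda>n. \<integral>x. indicator {l n..u n} x * F' x \<partial>lborel) \<longlonglongrightarrow> (\<integral>x. F' x \<partial>lborel)"
  proof (rule integral_dominated_convergence[where w = "\<lambda>x. \<bar>F' x\<bar>"])
    show "AE x in lborel. (\<lambda>n. indicator {l n..u n} x * F' x) \<longlonglongrightarrow> F' x"
    proof (rule AE_I2)
      fix x :: real
      have "eventually (\<lambda>n. indicator {l n..u n} x * F' x = F' x) sequentially"
        using eventually_ge_at_top[of "nat \<lceil>\<bar>x\<bar>\<rceil>"]
      proof eventually_elim
        case (elim n)
        hence "\<bar>x\<bar> \<le> real n" by linarith
        with l[of n] u[of n] have "x \<in> {l n..u n}" by auto
        thus ?case by simp
      qed
      thus "(\<lambda>n. indicator {l n..u n} x * F' x) \<longlonglongrightarrow> F' x"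
        by (rule tendsto_eventually)
    qed
  qed (use int in \<open>auto simp: indicator_def\<close>)
  moreover have "(\<lambda>n. F (u n) - F (l n)) \<longlonglongrightarrow> 0"
    using tendsto_diff[OF Fu Fl] by simp
  ultimately show ?thesis
    unfolding part by (rule LIMSEQ_unique)
qed

text \<open>
  Bessel's inequality for one unit vector \<open>v\<close>: the square of \<open>u - c v\<close> has a nonnegative integral,
  and with \<open>c = \<langle>u, v\<rangle>\<close> this integral is \<open>\<parallel>u\<parallel>\<^sup>2 - c\<^sup>2\<close>. It serves both for Hermite functions
  in \<open>L\<^sub>2(\<real>)\<close> and for the variables \<open>\<xi>\<^sub>k\<close> in \<open>L\<^sub>2(\<Omega>)\<close>.
\<close>

lemma integral_unit_square_Bessel:
  fixes u v :: "'a \<Rightarrow> real"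
  assumes [measurable]: "u \<in> borel_measurable M" "v \<in> borel_measurable M"
    and u2: "integrable M (\<lambda>x. (u x)\<^sup>2)" and v2: "integrable M (\<lambda>x. (v x)\<^sup>2)"
    and unit: "(\<integral>x. (v x)\<^sup>2 \<partial>M) = 1"
  shows "integrable M (\<lambda>x. u x * v x)" and "(\<integral>x. u x * v x \<partial>M)\<^sup>2 \<le> (\<integral>x. (u x)\<^sup>2 \<partial>M)"
proof -
  show uv: "integrable M (\<lambda>x. u x * v x)"
  proof (rule Bochner_Integration.integrable_bound)
    show "integrable M (\<lambda>x. (u x)\<^sup>2 + (v x)\<^sup>2)"
      using u2 v2 by simp
    have "\<bar>a * b\<bar> \<le> a\<^sup>2 + b\<^sup>2" for a b :: real
    proof -
      have "0 \<le> \<bar>a\<bar> * \<bar>b\<bar>" by simp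
      moreover have "2 * \<bar>a\<bar> * \<bar>b\<bar> \<le> a\<^sup>2 + b\<^sup>2"
        using sum_squares_bound[of "\<bar>a\<bar>" "\<bar>b\<bar>"] by simp
      ultimately show ?thesis unfolding abs_mult by linarith
    qed
    thus "AE x in M. norm (u x * v x) \<le> norm ((u x)\<^sup>2 + (v x)\<^sup>2)"
      by simp
  qed simp
  define c where "c = (\<integral>x. u x * v x \<partial>M)"
  have "0 \<le> (\<integral>x. (u x - c * v x)\<^sup>2 \<partial>M)"
    by simp
  also have "\<dots> = (\<integral>x. (u x)\<^sup>2 - 2 * c * (u x * v x) + c\<^sup>2 * (v x)\<^sup>2 \<partial>M)"
    by (simp add: power2_diff power_mult_distrib algebra_simps)
  also have "\<dots> = (\<integral>x. (u x)\<^sup>2 \<partial>M) - 2 * c * c + c\<^sup>2 * 1"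
    using uv u2 v2 unit by (simp add: c_def)
  finally show "c\<^sup>2 \<le> (\<integral>x. (u x)\<^sup>2 \<partial>M)"
    by (simp add: power2_eq_square)
qed

section \<open>Hermite polynomials\<close>

fun hermite_poly :: "nat \<Rightarrow> real poly" where
  "hermite_poly 0 = 1"
| "hermite_poly (Suc k) = [:0, 1:] * hermite_poly k - pderiv (hermite_poly k)"

text \<open>
  \<open>H\<^sub>k\<^sub>+\<^sub>1\<close> is kept folded so that \<open>H\<^sub>k\<^sub>+\<^sub>1' = (k + 1) H\<^sub>k\<close> can be applied to it.
\<close>

declare hermite_poly.simps(2) [simp del]

lemma DERIV_poly_gauss:
  "((\<lambda>x. poly q x * exp (- (c * x\<^sup>2))) has_real_derivative
     (poly (pderiv q) x - 2 * c * x * poly q x) * exp (- (c * x\<^sup>2))) (at x)"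
  by (auto intro!: derivative_eq_intros simp: algebra_simps)

lemma hermite_eq_poly: "hermite k x = poly (hermite_poly k) x"
proof -
  have "(deriv ^^ k) (\<lambda>y. exp (- y\<^sup>2 / 2)) =
          (\<lambda>y. (- 1) ^ k * (poly (hermite_poly k) y * exp (- (1 / 2 * y\<^sup>2))))"
  proof (induction k)
    case (Suc k)
    have "deriv (\<lambda>y. (- 1) ^ k * (poly (hermite_poly k) y * exp (- (1 / 2 * y\<^sup>2)))) y =
            (- 1) ^ k * ((poly (pderiv (hermite_poly k)) y - 2 * (1 / 2) * y * poly (hermite_poly k) y) *
              exp (- (1 / 2 * y\<^sup>2)))" for y
      by (intro DERIV_imp_deriv DERIV_cmult DERIV_poly_gauss)
    hence "deriv (\<lambda>y. (- 1) ^ k * (poly (hermite_poly k) y * exp (- (1 / 2 * y\<^sup>2)))) =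
            (\<lambda>y. (- 1) ^ Suc k * (poly (hermite_poly (Suc k)) y * exp (- (1 / 2 * y\<^sup>2))))"
      by (simp add: hermite_poly.simps(2) fun_eq_iff algebra_simps)
    thus ?case
      by (simp only: funpow.simps o_def Suc)
  qed simp
  thus ?thesis
    by (simp add: hermite_def exp_minus field_simps flip: power_mult_distrib)
qed

lemma pderiv_hermite_poly: "pderiv (hermite_poly (Suc k)) = smult (real (Suc k)) (hermite_poly k)"
proof (induction k)
  case 0
  show ?case by (simp add: hermite_poly.simps(2) pderiv_pCons)
next
  case (Suc k)
  have "pderiv (hermite_poly (Suc (Suc k))) =
          hermite_poly (Suc k) + [:0, 1:] * pderiv (hermite_poly (Suc k)) - pderiv (pderiv (hermite_poly (Suc k)))"
    by (subst hermite_poly.simps(2)) (simp add: pderiv_diff pderiv_mult pderiv_pCons)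
  also have "\<dots> = hermite_poly (Suc k) + smult (real (Suc k)) (hermite_poly (Suc k))"
    unfolding Suc by (simp add: hermite_poly.simps(2)[of k] pderiv_smult smult_diff_right)
  finally show ?case
    by (simp only: of_nat_Suc[of "Suc k"] smult_add_left smult_1_left)
qed

text \<open>
  Bounding a polynomial by \<open>C e\<^sup>|\<^sup>x\<^sup>|\<close> turns every comparison of a polynomial with a Gaussian into
  one concrete limit, whatever the degree.
\<close>

lemma poly_bound_exp:
  fixes q :: "real poly"
  obtains C where "C \<ge> 0" "\<And>x. \<bar>poly q x\<bar> \<le> C * exp \<bar>x\<bar>"
proof -
  have pow: "\<bar>x\<bar> ^ i \<le> fact i * exp \<bar>x\<bar>" for x :: real and i
  proof -
    have "\<bar>x\<bar> ^ i / fact i \<le> (\<Sum>j<Suc i. \<bar>x\<bar> ^ j / fact j)"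
      by (rule member_le_sum) auto
    also have "\<dots> \<le> (\<Sum>j. \<bar>x\<bar> ^ j / fact j)"
      using summable_exp[of "\<bar>x\<bar>"] by (intro sum_le_suminf) (auto simp: field_simps)
    also have "\<dots> = exp \<bar>x\<bar>"
      by (simp add: exp_def scaleR_conv_of_real field_simps)
    finally show ?thesis by (simp add: field_simps)
  qed
  have "\<bar>poly q x\<bar> \<le> (\<Sum>i\<le>degree q. \<bar>coeff q i\<bar> * fact i) * exp \<bar>x\<bar>" for x
  proof -
    have "\<bar>poly q x\<bar> \<le> (\<Sum>i\<le>degree q. \<bar>coeff q i * x ^ i\<bar>)"
      unfolding poly_altdef by (rule sum_abs)
    also have "\<dots> \<le> (\<Sum>i\<le>degree q. \<bar>coeff q i\<bar> * (fact i * exp \<bar>x\<bar>))"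
      by (intro sum_mono) (auto simp: abs_mult power_abs intro!: mult_left_mono pow)
    finally show ?thesis
      by (simp add: sum_distrib_right mult.assoc)
  qed
  thus ?thesis
    by (intro that[of "\<Sum>i\<le>degree q. \<bar>coeff q i\<bar> * fact i"]) (auto intro: sum_nonneg)
qed

lemma integrable_poly_gauss:
  fixes q :: "real poly"
  assumes "c > 0"
  shows "integrable lborel (\<lambda>x. poly q x * exp (- (c * x\<^sup>2)))"
proof -
  define s where "s = sqrt (1 / (2 * c))"
  have s: "s > 0" "s\<^sup>2 = 1 / (2 * c)"
    using assms by (auto simp: s_def)
  have "integrable lborel (\<lambda>x. x ^ i * exp (- (c * x\<^sup>2)))" for i
  proof -
    have "integrable lborel (\<lambda>x. sqrt (2 * pi * s\<^sup>2) * (normal_density 0 s x * (x - 0) ^ i))"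
      by (intro integrable_mult_right integrable_normal_moment s)
    also have "(\<lambda>x. sqrt (2 * pi * s\<^sup>2) * (normal_density 0 s x * (x - 0) ^ i)) =
                 (\<lambda>x. x ^ i * exp (- (c * x\<^sup>2)))"
      using s assms by (simp add: normal_density_def fun_eq_iff)
    finally show ?thesis .
  qed
  hence "integrable lborel (\<lambda>x. \<Sum>i\<le>degree q. coeff q i * (x ^ i * exp (- (c * x\<^sup>2))))"
    by (intro Bochner_Integration.integrable_sum integrable_mult_right)
  thus ?thesis
    by (simp add: poly_altdef sum_distrib_right mult.assoc)
qed

text \<open>
  The argument \<open>x\<close> of the polynomial and the argument \<open>y\<close> of the Gaussian are kept apart because
  the mean value theorem will bound a derivative at an unknown point of \<open>[n, n + 1]\<close> by Gaussian
  values at the end points.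
\<close>

lemma poly_gauss_le:
  assumes "c \<ge> 0" "C \<ge> 0" "\<bar>P\<bar> \<le> C * exp \<bar>x\<bar>" "real n \<le> \<bar>y\<bar>" "\<bar>x\<bar> \<le> real n + 1"
  shows "\<bar>P * exp (- (c * y\<^sup>2))\<bar> \<le> C * exp (real n + 1 - c * (real n)\<^sup>2)"
proof -
  have "(real n)\<^sup>2 \<le> y\<^sup>2"
    using assms(4) by (metis abs_le_square_iff abs_of_nat)
  hence "c * (real n)\<^sup>2 \<le> c * y\<^sup>2"
    using assms(1) by (rule mult_left_mono)
  have "\<bar>P * exp (- (c * y\<^sup>2))\<bar> \<le> (C * exp \<bar>x\<bar>) * exp (- (c * y\<^sup>2))"
    using assms(3) by (simp add: abs_mult)
  also have "\<dots> = C * exp (\<bar>x\<bar> - c * y\<^sup>2)"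
    by (simp add: exp_diff exp_minus field_simps)
  also have "\<dots> \<le> C * exp (real n + 1 - c * (real n)\<^sup>2)"
    using \<open>c * (real n)\<^sup>2 \<le> c * y\<^sup>2\<close> assms by (intro mult_left_mono) auto
  finally show ?thesis .
qed

lemma gauss_dominates_tendsto_0:
  assumes "c > 0"
  shows "(\<lambda>n. C * exp (real n + 1 - c * (real n)\<^sup>2)) \<longlonglongrightarrow> 0"
  using assms by real_asymp

lemma integral_poly_gauss_deriv:
  fixes q :: "real poly"
  assumes "c > 0"
  shows "(\<integral>x. (poly (pderiv q) x - 2 * c * x * poly q x) * exp (- (c * x\<^sup>2)) \<partial>lborel) = 0"
proof -
  obtain C where C: "C \<ge> 0" "\<And>x. \<bar>poly q x\<bar> \<le> C * exp \<bar>x\<bar>"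
    using poly_bound_exp[of q] by blast
  have lim: "(\<lambda>n. poly q (y n) * exp (- (c * (y n)\<^sup>2))) \<longlonglongrightarrow> 0"
    if "\<And>n. \<bar>y n\<bar> = real n" for y
    using gauss_dominates_tendsto_0[OF assms, of C]
  proof (rule Lim_null_comparison[rotated])
    show "eventually (\<lambda>n. norm (poly q (y n) * exp (- (c * (y n)\<^sup>2))) \<le>
            C * exp (real n + 1 - c * (real n)\<^sup>2)) sequentially"
    proof (intro always_eventually allI)
      fix n
      show "norm (poly q (y n) * exp (- (c * (y n)\<^sup>2))) \<le> C * exp (real n + 1 - c * (real n)\<^sup>2)"
        unfolding real_norm_def
        by (rule poly_gauss_le[OF _ C(1) C(2)]) (use assms that[of n] in simp_all)
    qed
  qed
  have "integrable lborel (\<lambda>x. poly (pderiv q - smult (2 * c) ([:0, 1:] * q)) x * exp (- (c * x\<^sup>2)))"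
    by (rule integrable_poly_gauss[OF assms])
  hence int: "integrable lborel (\<lambda>x. (poly (pderiv q) x - 2 * c * x * poly q x) * exp (- (c * x\<^sup>2)))"
    by (simp add: algebra_simps)
  show ?thesis
    by (rule integral_deriv_eq_0_if_vanishing_ends[OF DERIV_poly_gauss int,
          where l = "\<lambda>n. - real n" and u = real])
       (use lim[of "\<lambda>n. - real n"] lim[of real] in auto)
qed

text \<open>
  Induction on \<open>m\<close>: since \<open>H\<^sub>m\<^sub>+\<^sub>1 = x H\<^sub>m - H\<^sub>m'\<close> and \<open>H\<^sub>m\<^sub>+\<^sub>1' = (m + 1) H\<^sub>m\<close>, the derivative of
  \<open>H\<^sub>m\<^sub>+\<^sub>1 H\<^sub>m e\<^sup>-\<^sup>x\<^sup>2\<^sup>/\<^sup>2\<close> is \<open>((m + 1) H\<^sub>m\<^sup>2 - H\<^sub>m\<^sub>+\<^sub>1\<^sup>2) e\<^sup>-\<^sup>x\<^sup>2\<^sup>/\<^sup>2\<close>, and it integrates to zero.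
\<close>

lemma hermite_poly_norm:
  "(\<integral>x. (poly (hermite_poly m) x)\<^sup>2 * exp (- (1 / 2 * x\<^sup>2)) \<partial>lborel) = fact m * sqrt (2 * pi)"
proof (induction m)
  case 0
  have "(\<integral>x. sqrt (2 * pi) * normal_density 0 1 x \<partial>lborel) = sqrt (2 * pi)"
    by simp
  thus ?case
    by (simp add: normal_density_def)
next
  case (Suc m)
  let ?h = "\<lambda>x. poly (hermite_poly m) x" and ?h' = "\<lambda>x. poly (hermite_poly (Suc m)) x"
  let ?G = "\<lambda>x::real. exp (- (1 / 2 * x\<^sup>2))"
  define q where "q = hermite_poly (Suc m) * hermite_poly m"
  have sq: "integrable lborel (\<lambda>x. (poly (hermite_poly j) x)\<^sup>2 * ?G x)" for j
    using integrable_poly_gauss[of "1/2" "(hermite_poly j)\<^sup>2"] by (simp add: poly_power)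
  have "0 = (\<integral>x. (poly (pderiv q) x - 2 * (1/2) * x * poly q x) * ?G x \<partial>lborel)"
    by (rule integral_poly_gauss_deriv[symmetric]) simp
  also have "\<dots> = (\<integral>x. real (Suc m) * ((?h x)\<^sup>2 * ?G x) - (?h' x)\<^sup>2 * ?G x \<partial>lborel)"
  proof (intro Bochner_Integration.integral_cong refl)
    fix x
    have "poly (pderiv q) x - x * poly q x =
            real (Suc m) * (?h x)\<^sup>2 - ?h' x * (x * ?h x - poly (pderiv (hermite_poly m)) x)"
      unfolding q_def pderiv_mult pderiv_hermite_poly
      by (simp add: algebra_simps power2_eq_square)
    also have "x * ?h x - poly (pderiv (hermite_poly m)) x = ?h' x"
      by (simp add: hermite_poly.simps(2))
    finally have "poly (pderiv q) x - 2 * (1/2) * x * poly q x =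
            real (Suc m) * (?h x)\<^sup>2 - (?h' x)\<^sup>2"
      by (simp add: power2_eq_square)
    thus "(poly (pderiv q) x - 2 * (1/2) * x * poly q x) * ?G x =
            real (Suc m) * ((?h x)\<^sup>2 * ?G x) - (?h' x)\<^sup>2 * ?G x"
      by (simp only: left_diff_distrib mult.assoc)
  qed
  also have "\<dots> = real (Suc m) * (\<integral>x. (?h x)\<^sup>2 * ?G x \<partial>lborel) - (\<integral>x. (?h' x)\<^sup>2 * ?G x \<partial>lborel)"
    using sq[of m] sq[of "Suc m"] by simp
  finally show ?case
    unfolding Suc by simp
qed

lemma borel_measurable_poly [measurable]:
  fixes q :: "real poly"
  shows "poly q \<in> borel_measurable borel"
  by (intro borel_measurable_continuous_onI continuous_intros)

section \<open>Decay of the Hermite coefficients\<close>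

text \<open>
  A derivative is a pointwise limit of difference quotients, hence a Borel function even where it is
  discontinuous.
\<close>

lemma borel_measurable_deriv:
  fixes f :: "real \<Rightarrow> real"
  assumes "\<And>x. f differentiable (at x)"
  shows "deriv f \<in> borel_measurable borel"
proof (rule borel_measurable_LIMSEQ_real)
  have "continuous_on UNIV f"
    using assms by (simp add: continuous_on_eq_continuous_at differentiable_imp_continuous_within)
  hence [measurable]: "f \<in> borel_measurable borel"
    by (rule borel_measurable_continuous_onI)
  show "(\<lambda>x. (f (x + 1 / real (Suc n)) - f x) / (1 / real (Suc n))) \<in> borel_measurable borel" for n
    by measurable
  fix x :: real
  have "(f has_real_derivative deriv f x) (at x)"
    using assms by (simp add: DERIV_deriv_iff_real_differentiable)
  hence "((\<lambda>h. (f (x + h) - f x) / h) \<longlongrightarrow> deriv f x) (at 0)"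
    by (simp add: DERIV_def)
  moreover have "filterlim (\<lambda>n. 1 / real (Suc n)) (at 0) sequentially"
    unfolding filterlim_at using LIMSEQ_Suc[OF lim_const_over_n[of "1::real"]] by auto
  ultimately show "(\<lambda>n. (f (x + 1 / real (Suc n)) - f x) / (1 / real (Suc n))) \<longlonglongrightarrow> deriv f x"
    by (rule filterlim_compose)
qed

text \<open>
  Two integrations by parts in one step. Put \<open>w = e\<^sup>-\<^sup>x\<^sup>2\<^sup>/\<^sup>4\<close> and \<open>g = f w\<close>; then \<open>g'' = z w\<close>, which
  is where the differential expression \<open>z\<close> comes from. As \<open>H\<^sub>j' = j H\<^sub>j\<^sub>-\<^sub>1\<close>, the function
  \<open>F = g' H\<^sub>k\<^sub>+\<^sub>2 - (k + 2) g H\<^sub>k\<^sub>+\<^sub>1\<close> has derivative \<open>z w H\<^sub>k\<^sub>+\<^sub>2 - (k + 1) (k + 2) f w H\<^sub>k\<close>.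
  The delicate point is that \<open>F\<close> vanishes at infinity, since nothing is known about the growth of
  \<open>f'\<close>. But \<open>g\<close> is bounded by a Gaussian, so by the mean value theorem every interval
  \<open>(n, n + 1)\<close> contains a point where \<open>g'\<close> is as small as \<open>g\<close>, and such points suffice.
\<close>

lemma hermite_coefficient_by_parts:
  fixes f :: "real \<Rightarrow> real"
  defines "z \<equiv> \<lambda>x. deriv (deriv f) x - x * deriv f x + (x\<^sup>2 - 2) / 4 * f x"
  assumes f1: "\<And>x. f differentiable (at x)" and f2: "\<And>x. deriv f differentiable (at x)"
    and bounded: "bounded (range f)"
    and z_int: "integrable lborel (\<lambda>x. \<bar>z x\<bar>)"
  shows "z \<in> borel_measurable borel"
    and "(\<integral>x. z x * (poly (hermite_poly (k + 2)) x * exp (- (1 / 4 * x\<^sup>2))) \<partial>lborel) =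
           real ((k + 1) * (k + 2)) * (\<integral>x. f x * (poly (hermite_poly k) x * exp (- (1 / 4 * x\<^sup>2))) \<partial>lborel)"
proof -
  let ?w = "\<lambda>x::real. exp (- (1 / 4 * x\<^sup>2))"
  let ?h0 = "poly (hermite_poly k)" and ?h1 = "poly (hermite_poly (Suc k))"
    and ?h2 = "poly (hermite_poly (Suc (Suc k)))"
  have D1: "(f has_real_derivative deriv f x) (at x)" for x
    using f1 by (simp add: DERIV_deriv_iff_real_differentiable)
  have D2: "(deriv f has_real_derivative deriv (deriv f) x) (at x)" for x
    using f2 by (simp add: DERIV_deriv_iff_real_differentiable)
  have "continuous_on UNIV f"
    using f1 by (simp add: continuous_on_eq_continuous_at differentiable_imp_continuous_within)
  hence [measurable]: "f \<in> borel_measurable borel"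
    by (rule borel_measurable_continuous_onI)
  have [measurable]: "deriv f \<in> borel_measurable borel" "deriv (deriv f) \<in> borel_measurable borel"
    using borel_measurable_deriv f1 f2 by blast+
  show z_meas [measurable]: "z \<in> borel_measurable borel"
    unfolding z_def by measurable
  obtain B where B: "\<And>x. \<bar>f x\<bar> \<le> B"
    using bounded by (auto simp: bounded_iff)
  have "B \<ge> 0"
    using B[of 0] by linarith

  define g where "g x = f x * ?w x" for x
  define g' where "g' x = (deriv f x - x / 2 * f x) * ?w x" for x
  have Dg: "(g has_real_derivative g' x) (at x)" for x
    unfolding g_def g'_def by (auto intro!: derivative_eq_intros D1 simp: algebra_simps)
  have Dg': "(g' has_real_derivative z x * ?w x) (at x)" for x
    unfolding g'_def z_def
    by (auto intro!: derivative_eq_intros D1 D2 simp: field_simps power2_eq_square)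
  have Dh: "(poly (hermite_poly (Suc j)) has_real_derivative real (Suc j) * poly (hermite_poly j) x) (at x)" for j x
    using poly_DERIV[of "hermite_poly (Suc j)" x] unfolding pderiv_hermite_poly by simp

  define F where "F x = g' x * ?h2 x - real (Suc (Suc k)) * (g x * ?h1 x)" for x
  have DF: "(F has_real_derivative
      z x * (?h2 x * ?w x) - real ((k + 1) * (k + 2)) * (f x * (?h0 x * ?w x))) (at x)" for x
  proof -
    have "(F has_real_derivative
        (z x * ?w x) * ?h2 x + (real (Suc (Suc k)) * ?h1 x) * g' x -
        real (Suc (Suc k)) * (g' x * ?h1 x + (real (Suc k) * ?h0 x) * g x)) (at x)"
      unfolding F_def by (intro DERIV_diff DERIV_cmult DERIV_mult Dg Dg' Dh)
    thus ?thesis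
      by (rule DERIV_cong) (simp add: g_def algebra_simps)
  qed

  obtain C1 where C1: "C1 \<ge> 0" "\<And>x. \<bar>?h1 x\<bar> \<le> C1 * exp \<bar>x\<bar>"
    using poly_bound_exp[of "hermite_poly (Suc k)"] by blast
  obtain C2 where C2: "C2 \<ge> 0" "\<And>x. \<bar>?h2 x\<bar> \<le> C2 * exp \<bar>x\<bar>"
    using poly_bound_exp[of "hermite_poly (Suc (Suc k))"] by blast

  have int0: "integrable lborel (\<lambda>x. f x * (?h0 x * ?w x))"
  proof (rule Bochner_Integration.integrable_bound)
    show "integrable lborel (\<lambda>x. B * (?h0 x * ?w x))"
      by (intro integrable_mult_right integrable_poly_gauss) simp
    have "\<bar>f x * (?h0 x * ?w x)\<bar> \<le> \<bar>B * (?h0 x * ?w x)\<bar>" for x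
      using B[of x] \<open>B \<ge> 0\<close> by (simp add: abs_mult mult_right_mono)
    thus "AE x in lborel. norm (f x * (?h0 x * ?w x)) \<le> norm (B * (?h0 x * ?w x))"
      by simp
  qed measurable
  have int2: "integrable lborel (\<lambda>x. z x * (?h2 x * ?w x))"
  proof (rule Bochner_Integration.integrable_bound)
    show "integrable lborel (\<lambda>x. C2 * exp 1 * \<bar>z x\<bar>)"
      by (intro integrable_mult_right z_int)
    have "\<bar>?h2 x * ?w x\<bar> \<le> C2 * exp 1" for x
    proof -
      have quad: "\<bar>x\<bar> - 1 / 4 * x\<^sup>2 \<le> 1"
        using zero_le_power2[of "\<bar>x\<bar> / 2 - 1"] by (simp add: power2_diff power_divide)
      have "\<bar>?h2 x * ?w x\<bar> \<le> C2 * exp \<bar>x\<bar> * ?w x"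
        using C2(2)[of x] by (simp add: abs_mult)
      also have "\<dots> = C2 * exp (\<bar>x\<bar> - 1 / 4 * x\<^sup>2)"
        by (simp only: mult.assoc exp_add[symmetric] diff_conv_add_uminus)
      also have "\<dots> \<le> C2 * exp 1"
        using C2(1) quad by (intro mult_left_mono) auto
      finally show ?thesis .
    qed
    hence "\<bar>z x * (?h2 x * ?w x)\<bar> \<le> \<bar>z x\<bar> * (C2 * exp 1)" for x
      unfolding abs_mult[of "z x"] by (intro mult_left_mono) auto
    thus "AE x in lborel. norm (z x * (?h2 x * ?w x)) \<le> norm (C2 * exp 1 * \<bar>z x\<bar>)"
      using C2(1) by (simp add: abs_mult mult_ac)
  qed measurable

  have g_bound: "\<bar>g y\<bar> \<le> B * exp (- (1 / 4 * (real n)\<^sup>2))" if "real n \<le> \<bar>y\<bar>" for n y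
  proof -
    have "(real n)\<^sup>2 \<le> y\<^sup>2"
      using that by (metis abs_le_square_iff abs_of_nat)
    thus ?thesis
      using B[of y] \<open>B \<ge> 0\<close> unfolding g_def abs_mult by (intro mult_mono) auto
  qed
  \<comment> \<open>Every unit interval far from the origin contains a point where \<open>F\<close> is small: the mean value
    theorem controls \<open>g'\<close> there by the values of \<open>g\<close> at the two ends.\<close>
  define K where "K = 2 * B * C2 + real (Suc (Suc k)) * (B * C1)"
  have point: "\<exists>x. a < x \<and> x < b \<and> \<bar>F x\<bar> \<le> K * exp (real n + 1 - 1 / 4 * (real n)\<^sup>2)"
    if ab: "b = a + 1" and out: "\<And>x. a \<le> x \<Longrightarrow> x \<le> b \<Longrightarrow> real n \<le> \<bar>x\<bar> \<and> \<bar>x\<bar> \<le> real n + 1" for a b n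
  proof -
    let ?e = "exp (real n + 1 - 1 / 4 * (real n)\<^sup>2)"
    obtain x where x: "a < x" "x < b" "g b - g a = (b - a) * g' x"
      using MVT2[of a b g g'] Dg ab by auto
    have "\<bar>g' x\<bar> \<le> 2 * B * exp (- (1 / 4 * (real n)\<^sup>2))"
      using x g_bound[of n a] g_bound[of n b] out[of a] out[of b] ab by auto
    hence "\<bar>g' x * ?h2 x\<bar> \<le> 2 * B * exp (- (1 / 4 * (real n)\<^sup>2)) * \<bar>?h2 x\<bar>"
      unfolding abs_mult by (intro mult_right_mono) auto
    also have "\<dots> = 2 * B * \<bar>?h2 x * exp (- (1 / 4 * (real n)\<^sup>2))\<bar>"
      by (simp add: abs_mult)
    also have "\<dots> \<le> 2 * B * (C2 * ?e)"
      using out[of x] x \<open>B \<ge> 0\<close> C2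
      by (intro mult_left_mono poly_gauss_le[of "1/4" C2 _ x]) auto
    finally have 1: "\<bar>g' x * ?h2 x\<bar> \<le> 2 * B * (C2 * ?e)" .
    have "\<bar>g x * ?h1 x\<bar> = \<bar>f x\<bar> * \<bar>?h1 x * ?w x\<bar>"
      by (simp add: g_def abs_mult)
    also have "\<dots> \<le> B * (C1 * ?e)"
      using out[of x] x \<open>B \<ge> 0\<close> C1 B[of x]
      by (intro mult_mono poly_gauss_le[of "1/4" C1 _ x]) auto
    finally have "real (Suc (Suc k)) * \<bar>g x * ?h1 x\<bar> \<le> real (Suc (Suc k)) * (B * (C1 * ?e))"
      by (intro mult_left_mono) auto
    moreover have "\<bar>F x\<bar> \<le> \<bar>g' x * ?h2 x\<bar> + real (Suc (Suc k)) * \<bar>g x * ?h1 x\<bar>"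
      unfolding F_def
      by (rule order_trans[OF abs_triangle_ineq4]) (simp add: abs_mult)
    ultimately have "\<bar>F x\<bar> \<le> 2 * B * (C2 * ?e) + real (Suc (Suc k)) * (B * (C1 * ?e))"
      using 1 by linarith
    also have "\<dots> = K * ?e"
      by (simp only: K_def distrib_right mult.assoc)
    finally show ?thesis
      using x by blast
  qed
  have "\<forall>n. \<exists>x. real n < x \<and> x < real n + 1 \<and> \<bar>F x\<bar> \<le> K * exp (real n + 1 - 1 / 4 * (real n)\<^sup>2)"
    by (intro allI point) auto
  then obtain u where u: "\<And>n. real n < u n"
      "\<And>n. \<bar>F (u n)\<bar> \<le> K * exp (real n + 1 - 1 / 4 * (real n)\<^sup>2)"
    by metis
  have "\<forall>n. \<exists>x. - real n - 1 < x \<and> x < - real n \<and> \<bar>F x\<bar> \<le> K * exp (real n + 1 - 1 / 4 * (real n)\<^sup>2)"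
    by (intro allI point) auto
  then obtain l where l: "\<And>n. l n < - real n"
      "\<And>n. \<bar>F (l n)\<bar> \<le> K * exp (real n + 1 - 1 / 4 * (real n)\<^sup>2)"
    by metis
  have lim: "(\<lambda>n. K * exp (real n + 1 - 1 / 4 * (real n)\<^sup>2)) \<longlonglongrightarrow> 0"
    by (rule gauss_dominates_tendsto_0) simp
  have "(\<integral>x. z x * (?h2 x * ?w x) - real ((k + 1) * (k + 2)) * (f x * (?h0 x * ?w x)) \<partial>lborel) = 0"
  proof (rule integral_deriv_eq_0_if_vanishing_ends[OF DF])
    show "integrable lborel (\<lambda>x. z x * (?h2 x * ?w x) - real ((k + 1) * (k + 2)) * (f x * (?h0 x * ?w x)))"
      by (intro Bochner_Integration.integrable_diff integrable_mult_right int0 int2)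
    show "(\<lambda>n. F (l n)) \<longlonglongrightarrow> 0" "(\<lambda>n. F (u n)) \<longlonglongrightarrow> 0"
      using l u by (auto intro!: Lim_null_comparison[OF _ lim] always_eventually)
    show "l n \<le> - real n" "real n \<le> u n" for n
      using l(1)[of n] u(1)[of n] by auto
  qed
  also have "(\<integral>x. z x * (?h2 x * ?w x) - real ((k + 1) * (k + 2)) * (f x * (?h0 x * ?w x)) \<partial>lborel) =
     (\<integral>x. z x * (?h2 x * ?w x) \<partial>lborel) - real ((k + 1) * (k + 2)) * (\<integral>x. f x * (?h0 x * ?w x) \<partial>lborel)"
    by (subst Bochner_Integration.integral_diff) (use int0 int2 in auto)
  finally show "(\<integral>x. z x * (poly (hermite_poly (k + 2)) x * ?w x) \<partial>lborel) =
      real ((k + 1) * (k + 2)) * (\<integral>x. f x * (?h0 x * ?w x) \<partial>lborel)"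
    by simp
qed

definition hermite_const :: "nat \<Rightarrow> real" where
  "hermite_const k = sqrt (fact k) * root 4 (2 * pi)"

lemma hermite_const_pos: "hermite_const k > 0"
  by (simp add: hermite_const_def)

lemma hermite_const_square: "(hermite_const k)\<^sup>2 = fact k * sqrt (2 * pi)"
proof -
  have "root 4 (2 * pi) = sqrt (sqrt (2 * pi))"
    using real_root_mult_exp[of 2 2 "2 * pi"] by (simp add: sqrt_def)
  thus ?thesis
    by (simp add: hermite_const_def power_mult_distrib)
qed

lemma hermite_fun_eq_poly:
  "hermite_fun k x = poly (hermite_poly k) x * exp (- (1 / 4 * x\<^sup>2)) / hermite_const k"
  by (simp add: hermite_fun_def hermite_const_def hermite_eq_poly)

lemma borel_measurable_hermite_fun: "hermite_fun k \<in> borel_measurable borel"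
  unfolding hermite_fun_eq_poly[abs_def] by measurable

lemma hermite_fun_unit:
  "integrable lborel (\<lambda>x. (hermite_fun k x)\<^sup>2)" "(\<integral>x. (hermite_fun k x)\<^sup>2 \<partial>lborel) = 1"
proof -
  have eq: "(hermite_fun k x)\<^sup>2 =
      (poly (hermite_poly k) x)\<^sup>2 * exp (- (1 / 2 * x\<^sup>2)) / (hermite_const k)\<^sup>2" for x
  proof -
    have "(exp (- (1 / 4 * x\<^sup>2)))\<^sup>2 = exp (- (1 / 2 * x\<^sup>2))"
      by (simp add: exp_double[symmetric])
    thus ?thesis
      by (simp add: hermite_fun_eq_poly power_divide power_mult_distrib)
  qed
  have "integrable lborel (\<lambda>x. poly ((hermite_poly k)\<^sup>2) x * exp (- (1 / 2 * x\<^sup>2)))"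
    by (rule integrable_poly_gauss) simp
  thus "integrable lborel (\<lambda>x. (hermite_fun k x)\<^sup>2)"
    unfolding eq by simp
  show "(\<integral>x. (hermite_fun k x)\<^sup>2 \<partial>lborel) = 1"
    unfolding eq using hermite_poly_norm[of k] by (simp add: hermite_const_square)
qed

text \<open>
  Integration by parts says \<open>\<langle>z, h\<^sub>k\<^sub>+\<^sub>2\<rangle>\<^sup>2 = (k + 1) (k + 2) a\<^sub>k\<^sup>2\<close> for the
  normalised Hermite functions \<open>h\<^sub>j\<close>, and Bessel's inequality bounds the left-hand side by the
  square integral of \<open>z\<close>. The statement is extended-valued because that integral may be infinite.
\<close>

lemma coeff_fun_square_bound:
  assumes "\<And>x. f t differentiable (at x)" and "\<And>x. deriv (f t) differentiable (at x)"
    and "bounded (range (f t))" and "integrable lborel (Z f t)"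
  shows "ennreal ((coeff_fun f k t)\<^sup>2 * ((real k)\<^sup>2 + 3 * real k + 2)) \<le> (\<integral>\<^sup>+x. ennreal ((Z f t x)\<^sup>2) \<partial>lborel)"
proof (cases "(\<integral>\<^sup>+x. ennreal ((Z f t x)\<^sup>2) \<partial>lborel) = \<top>")
  case False
  define z where "z x = deriv (deriv (f t)) x - x * deriv (f t) x + (x\<^sup>2 - 2) / 4 * f t x" for x
  have Z_eq: "Z f t = (\<lambda>x. \<bar>z x\<bar>)"
    by (simp add: fun_eq_iff Z_def z_def)
  let ?I = "\<integral>x. f t x * (poly (hermite_poly k) x * exp (- (1 / 4 * x\<^sup>2))) \<partial>lborel"
  note by_parts = hermite_coefficient_by_parts[of "f t", folded z_def, OF assms(1-3)]
  have z_int: "integrable lborel (\<lambda>x. \<bar>z x\<bar>)"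
    using assms(4) by (simp add: Z_eq)
  have [measurable]: "z \<in> borel_measurable borel"
    by (rule by_parts(1)[OF z_int])
  have z2: "integrable lborel (\<lambda>x. (z x)\<^sup>2)"
    using False by (intro integrableI_bounded) (auto simp: Z_eq top.not_eq_extremum)
  have "hermite_const (k + 2) * (\<integral>x. z x * hermite_fun (k + 2) x \<partial>lborel) =
          (\<integral>x. z x * (poly (hermite_poly (k + 2)) x * exp (- (1 / 4 * x\<^sup>2))) \<partial>lborel)"
    using hermite_const_pos[of "k + 2"]
    by (simp add: hermite_fun_eq_poly del: add_2_eq_Suc')
  also have "\<dots> = real ((k + 1) * (k + 2)) * ?I"
    by (rule by_parts(2)[OF z_int])
  also have "?I = hermite_const k * coeff_fun f k t"
    using hermite_const_pos[of k] by (simp add: coeff_fun_def hermite_fun_eq_poly)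
  finally have "hermite_const (k + 2) * (\<integral>x. z x * hermite_fun (k + 2) x \<partial>lborel) =
      real ((k + 1) * (k + 2)) * (hermite_const k * coeff_fun f k t)" .
  from arg_cong[OF this, of "\<lambda>r. r\<^sup>2"]
  have scaled: "(hermite_const (k + 2))\<^sup>2 * (\<integral>x. z x * hermite_fun (k + 2) x \<partial>lborel)\<^sup>2 =
      (real ((k + 1) * (k + 2)))\<^sup>2 * ((hermite_const k)\<^sup>2 * (coeff_fun f k t)\<^sup>2)"
    by (simp only: power_mult_distrib)
  have const: "(hermite_const (k + 2))\<^sup>2 = real ((k + 1) * (k + 2)) * (hermite_const k)\<^sup>2"
    by (simp add: hermite_const_square algebra_simps)
  have cancel: "i = n * a" if "n * c * i = n\<^sup>2 * (c * a)" "n > 0" "c > 0" for n c i a :: real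
    using that by (simp add: power2_eq_square)
  have "(\<integral>x. z x * hermite_fun (k + 2) x \<partial>lborel)\<^sup>2 = real ((k + 1) * (k + 2)) * (coeff_fun f k t)\<^sup>2"
  proof (rule cancel[OF scaled[unfolded const]])
    show "0 < real ((k + 1) * (k + 2))" by (simp only: of_nat_0_less_iff) simp
    show "0 < (hermite_const k)\<^sup>2" using hermite_const_pos[of k] by simp
  qed
  moreover have "(\<integral>x. z x * hermite_fun (k + 2) x \<partial>lborel)\<^sup>2 \<le> (\<integral>x. (z x)\<^sup>2 \<partial>lborel)"
    using z2 hermite_fun_unit by (intro integral_unit_square_Bessel) (auto intro: borel_measurable_hermite_fun)
  moreover have "real ((k + 1) * (k + 2)) = (real k)\<^sup>2 + 3 * real k + 2"
    by (simp add: power2_eq_square algebra_simps)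
  ultimately have "(coeff_fun f k t)\<^sup>2 * ((real k)\<^sup>2 + 3 * real k + 2) \<le> (\<integral>x. (z x)\<^sup>2 \<partial>lborel)"
    by (simp only: mult.commute[of "(coeff_fun f k t)\<^sup>2"])
  hence "ennreal ((coeff_fun f k t)\<^sup>2 * ((real k)\<^sup>2 + 3 * real k + 2)) \<le> ennreal (\<integral>x. (z x)\<^sup>2 \<partial>lborel)"
    by (rule ennreal_leI)
  also have "\<dots> = (\<integral>\<^sup>+x. ennreal ((Z f t x)\<^sup>2) \<partial>lborel)"
    using nn_integral_eq_integral[OF z2] by (simp add: Z_eq)
  finally show ?thesis .
qed simp

section \<open>Moment generating functions of sub-Gaussian sums\<close>

text \<open>
  This single formula replaces the case distinction: \<open>\<phi>(t) / t\<^sup>2\<close> is a continuous nondecreasing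
  function of \<open>|t|\<close>, and all properties of \<open>\<phi>\<close> below are read off from that.
\<close>

lemma phi_eq_max:
  assumes "\<gamma> > 2"
  shows "phi \<gamma> t = t\<^sup>2 * max 1 \<bar>t\<bar> powr (\<gamma> - 2) / \<gamma>"
proof (cases "\<bar>t\<bar> < 1")
  case False
  hence "t\<^sup>2 * \<bar>t\<bar> powr (\<gamma> - 2) = \<bar>t\<bar> powr 2 * \<bar>t\<bar> powr (\<gamma> - 2)"
    by (subst powr_numeral) auto
  also have "\<dots> = \<bar>t\<bar> powr \<gamma>"
    by (simp only: powr_add[symmetric]) simp
  finally show ?thesis
    using False by (simp add: phi_def max_def)
qed (simp add: phi_def)

lemma phi_0 [simp]: "phi \<gamma> 0 = 0"
  by (simp add: phi_def)

lemma phi_minus [simp]: "phi \<gamma> (- t) = phi \<gamma> t"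
  by (simp add: phi_def)

lemma continuous_on_phi:
  assumes "\<gamma> > 2"
  shows "continuous_on UNIV (phi \<gamma>)"
proof -
  have "continuous_on UNIV (\<lambda>t. t\<^sup>2 * max 1 \<bar>t\<bar> powr (\<gamma> - 2) / \<gamma>)"
    using assms by (intro continuous_intros) auto
  thus ?thesis
    using phi_eq_max[OF assms] by (simp cong: continuous_on_cong)
qed

lemma phi_mono:
  assumes "\<gamma> > 2" "\<bar>s\<bar> \<le> \<bar>t\<bar>"
  shows "phi \<gamma> s \<le> phi \<gamma> t"
proof -
  have "s\<^sup>2 \<le> t\<^sup>2"
    using assms(2) by (simp add: abs_le_square_iff)
  thus ?thesis
    unfolding phi_eq_max[OF assms(1)] using assms
    by (intro divide_right_mono mult_mono powr_mono2) auto
qed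

text \<open>
  Replacing every factor \<open>\<phi>(x\<^sub>i) / x\<^sub>i\<^sup>2\<close> by its value at \<open>(\<Sum>x\<^sub>i\<^sup>2)\<^sup>1\<^sup>/\<^sup>2\<close> can only increase the sum.
  This inequality is what makes the squares of the
  sub-Gaussian norms add up over independent summands.
\<close>

lemma sum_phi_le:
  assumes "\<gamma> > 2" "finite I"
  shows "(\<Sum>i\<in>I. phi \<gamma> (x i)) \<le> phi \<gamma> (sqrt (\<Sum>i\<in>I. (x i)\<^sup>2))"
proof -
  let ?R = "sqrt (\<Sum>i\<in>I. (x i)\<^sup>2)"
  have le_R: "\<bar>x i\<bar> \<le> \<bar>?R\<bar>" if "i \<in> I" for i
  proof -
    have "(x i)\<^sup>2 \<le> (\<Sum>i\<in>I. (x i)\<^sup>2)"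
      by (rule member_le_sum) (use that assms in auto)
    hence "sqrt ((x i)\<^sup>2) \<le> ?R"
      by (rule real_sqrt_le_mono)
    thus ?thesis by simp
  qed
  have "(\<Sum>i\<in>I. phi \<gamma> (x i)) \<le> (\<Sum>i\<in>I. (x i)\<^sup>2 * max 1 \<bar>?R\<bar> powr (\<gamma> - 2) / \<gamma>)"
    unfolding phi_eq_max[OF assms(1)] using assms(1) le_R
    by (intro sum_mono divide_right_mono mult_left_mono powr_mono2 max.mono) auto
  also have "\<dots> = (\<Sum>i\<in>I. (x i)\<^sup>2) * max 1 \<bar>?R\<bar> powr (\<gamma> - 2) / \<gamma>"
    by (simp add: sum_distrib_right sum_divide_distrib)
  also have "\<dots> = phi \<gamma> ?R"
    unfolding phi_eq_max[OF assms(1)] by (simp add: sum_nonneg)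
  finally show ?thesis .
qed

text \<open>
  The infimum that defines the norm is a minimum, by continuity of \<open>\<phi>\<close>.
\<close>

lemma sub_norm_attained:
  assumes "\<gamma> > 2" "\<xi> \<in> Sub M (phi \<gamma>)"
  shows "(\<integral>\<^sup>+\<omega>. ennreal (exp (u * \<xi> \<omega>)) \<partial>M) \<le> ennreal (exp (phi \<gamma> (sub_norm M (phi \<gamma>) \<xi> * u)))"
proof -
  let ?A = "sub_gaussian_bounds M (phi \<gamma>) \<xi>" and ?\<tau> = "sub_norm M (phi \<gamma>) \<xi>"
  have ne: "?A \<noteq> {}"
    using assms(2) by (simp add: Sub_def)
  have nonneg: "a \<ge> 0" if "a \<in> ?A" for a
    using that by (simp add: sub_gaussian_bounds_def)
  have approx: "(\<integral>\<^sup>+\<omega>. ennreal (exp (u * \<xi> \<omega>)) \<partial>M) \<le> ennreal (exp (phi \<gamma> ((?\<tau> + 1 / real (Suc n)) * u)))" for n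
  proof -
    have "Inf ?A < ?\<tau> + 1 / real (Suc n)"
      by (simp add: sub_norm_def)
    then obtain a where a: "a \<in> ?A" "a < ?\<tau> + 1 / real (Suc n)"
      using ne nonneg by (subst (asm) cInf_less_iff) (auto intro!: bdd_belowI)
    have "(\<integral>\<^sup>+\<omega>. ennreal (exp (u * \<xi> \<omega>)) \<partial>M) \<le> ennreal (exp (phi \<gamma> (a * u)))"
      using a(1) by (simp add: sub_gaussian_bounds_def)
    also have "\<dots> \<le> ennreal (exp (phi \<gamma> ((?\<tau> + 1 / real (Suc n)) * u)))"
      using a nonneg[OF a(1)] by (auto simp: abs_mult intro!: ennreal_leI phi_mono[OF assms(1)] mult_right_mono)
    finally show ?thesis .
  qed
  have lim: "(\<lambda>n. ?\<tau> + 1 / real (Suc n)) \<longlonglongrightarrow> ?\<tau>"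
    using LIMSEQ_inverse_real_of_nat_add[of ?\<tau>] by (simp add: inverse_eq_divide)
  have "isCont (phi \<gamma>) (?\<tau> * u)"
    using continuous_on_phi[OF assms(1)] by (simp add: continuous_on_eq_continuous_at)
  hence "(\<lambda>n. phi \<gamma> ((?\<tau> + 1 / real (Suc n)) * u)) \<longlonglongrightarrow> phi \<gamma> (?\<tau> * u)"
    by (rule isCont_tendsto_compose) (intro tendsto_mult lim tendsto_const)
  hence "(\<lambda>n. ennreal (exp (phi \<gamma> ((?\<tau> + 1 / real (Suc n)) * u)))) \<longlonglongrightarrow> ennreal (exp (phi \<gamma> (?\<tau> * u)))"
    by (intro tendsto_ennrealI tendsto_exp)
  thus "(\<integral>\<^sup>+\<omega>. ennreal (exp (u * \<xi> \<omega>)) \<partial>M) \<le> ennreal (exp (phi \<gamma> (?\<tau> * u)))"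
    by (rule LIMSEQ_le_const) (use approx in blast)
qed

lemma (in prob_space) mgf_indep_sum_le:
  assumes "\<gamma> > 2" and indep: "indep_vars (\<lambda>_. borel) \<xi> I" and "finite I"
    and sub: "\<And>k. k \<in> I \<Longrightarrow> \<xi> k \<in> Sub M (phi \<gamma>)"
  shows "(\<integral>\<^sup>+\<omega>. ennreal (exp (u * (\<Sum>k\<in>I. b k * \<xi> k \<omega>))) \<partial>M) \<le>
           ennreal (exp (phi \<gamma> (u * sqrt (\<Sum>k\<in>I. (sub_norm M (phi \<gamma>) (\<xi> k))\<^sup>2 * (b k)\<^sup>2))))"
proof -
  let ?\<tau> = "\<lambda>k. sub_norm M (phi \<gamma>) (\<xi> k)"
  have "(\<integral>\<^sup>+\<omega>. ennreal (exp (u * (\<Sum>k\<in>I. b k * \<xi> k \<omega>))) \<partial>M) =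
          (\<integral>\<^sup>+\<omega>. (\<Prod>k\<in>I. ennreal (exp (u * b k * \<xi> k \<omega>))) \<partial>M)"
    using \<open>finite I\<close> by (simp add: exp_sum[symmetric] prod_ennreal sum_distrib_left mult.assoc)
  also have "\<dots> = (\<Prod>k\<in>I. \<integral>\<^sup>+\<omega>. ennreal (exp (u * b k * \<xi> k \<omega>)) \<partial>M)"
  proof (rule indep_vars_nn_integral[OF \<open>finite I\<close>])
    show "indep_vars (\<lambda>_. borel) (\<lambda>k \<omega>. ennreal (exp (u * b k * \<xi> k \<omega>))) I"
      by (rule indep_vars_compose2[OF indep]) measurable
  qed simp
  also have "\<dots> \<le> (\<Prod>k\<in>I. ennreal (exp (phi \<gamma> (?\<tau> k * (u * b k)))))"
    by (intro prod_mono_ennreal sub_norm_attained assms)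
  also have "\<dots> = ennreal (exp (\<Sum>k\<in>I. phi \<gamma> (?\<tau> k * (u * b k))))"
    using \<open>finite I\<close> by (simp add: exp_sum prod_ennreal)
  also have "\<dots> \<le> ennreal (exp (phi \<gamma> (sqrt (\<Sum>k\<in>I. (?\<tau> k * (u * b k))\<^sup>2))))"
    using sum_phi_le[OF \<open>\<gamma> > 2\<close> \<open>finite I\<close>] by (intro ennreal_leI) simp
  also have "(\<Sum>k\<in>I. (?\<tau> k * (u * b k))\<^sup>2) = u\<^sup>2 * (\<Sum>k\<in>I. (?\<tau> k)\<^sup>2 * (b k)\<^sup>2)"
    by (simp add: sum_distrib_left power_mult_distrib mult_ac)
  also have "ennreal (exp (phi \<gamma> (sqrt \<dots>))) \<le> ennreal (exp (phi \<gamma> (u * sqrt (\<Sum>k\<in>I. (?\<tau> k)\<^sup>2 * (b k)\<^sup>2))))"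
    by (auto intro!: ennreal_leI phi_mono[OF \<open>\<gamma> > 2\<close>] simp: real_sqrt_mult abs_mult)
  finally show ?thesis .
qed

text \<open>
  Convergence in mean square yields almost sure convergence along a subsequence, and then Fatou's
  lemma carries a bound on the moment generating functions over to the limit.
\<close>

lemma mgf_le_of_L2_limit:
  fixes S :: "nat \<Rightarrow> 'a \<Rightarrow> real"
  assumes [measurable]: "Y \<in> borel_measurable M" "\<And>n. S n \<in> borel_measurable M"
    and int: "\<And>n. integrable M (\<lambda>\<omega>. (Y \<omega> - S n \<omega>)\<^sup>2)"
    and lim: "(\<lambda>n. \<integral>\<omega>. (Y \<omega> - S n \<omega>)\<^sup>2 \<partial>M) \<longlonglongrightarrow> 0"
    and le: "\<And>n. (\<integral>\<^sup>+\<omega>. ennreal (exp (u * S n \<omega>)) \<partial>M) \<le> C"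
  shows "(\<integral>\<^sup>+\<omega>. ennreal (exp (u * Y \<omega>)) \<partial>M) \<le> C"
proof -
  have "\<exists>r::nat \<Rightarrow> nat. strict_mono r \<and> (AE \<omega> in M. (\<lambda>n. (Y \<omega> - S (r n) \<omega>)\<^sup>2) \<longlonglongrightarrow> 0)"
    using tendsto_L1_AE_subseq[of M "\<lambda>n \<omega>. (Y \<omega> - S n \<omega>)\<^sup>2"] int lim by simp
  then obtain r :: "nat \<Rightarrow> nat" where r: "AE \<omega> in M. (\<lambda>n. (Y \<omega> - S (r n) \<omega>)\<^sup>2) \<longlonglongrightarrow> 0"
    by blast
  have "AE \<omega> in M. ennreal (exp (u * Y \<omega>)) \<le> liminf (\<lambda>n. ennreal (exp (u * S (r n) \<omega>)))"
    using r
  proof eventually_elim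
    case (elim \<omega>)
    have "(\<lambda>n. Y \<omega> - (Y \<omega> - S (r n) \<omega>)) \<longlonglongrightarrow> Y \<omega> - 0"
      using elim by (intro tendsto_intros) (simp add: power_tendsto_0_iff)
    hence "(\<lambda>n. ennreal (exp (u * S (r n) \<omega>))) \<longlonglongrightarrow> ennreal (exp (u * Y \<omega>))"
      by (intro tendsto_ennrealI tendsto_intros) simp
    thus ?case
      using lim_imp_Liminf[OF sequentially_bot] by fastforce
  qed
  hence "(\<integral>\<^sup>+\<omega>. ennreal (exp (u * Y \<omega>)) \<partial>M) \<le> (\<integral>\<^sup>+\<omega>. liminf (\<lambda>n. ennreal (exp (u * S (r n) \<omega>))) \<partial>M)"
    by (rule nn_integral_mono_AE)
  also have "\<dots> \<le> liminf (\<lambda>n. \<integral>\<^sup>+\<omega>. ennreal (exp (u * S (r n) \<omega>)) \<partial>M)"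
    by (rule nn_integral_liminf) measurable
  also have "\<dots> \<le> liminf (\<lambda>n. C)"
    by (intro Liminf_mono always_eventually allI le)
  also have "\<dots> = C"
    by (simp add: Liminf_const)
  finally show ?thesis .
qed

text \<open>
  Since \<open>e\<^sup>y + e\<^sup>-\<^sup>y = 2 + (e\<^sup>y\<^sup>/\<^sup>2 - e\<^sup>-\<^sup>y\<^sup>/\<^sup>2)\<^sup>2\<close>, the bounds at \<open>u = 1\<close> and \<open>u = -1\<close> leave no room for the
  square.
\<close>

lemma (in prob_space) AE_zero_if_mgf_le_1:
  assumes [measurable]: "Y \<in> borel_measurable M"
    and le: "\<And>u. (\<integral>\<^sup>+\<omega>. ennreal (exp (u * Y \<omega>)) \<partial>M) \<le> 1"
  shows "AE \<omega> in M. Y \<omega> = 0"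
proof -
  let ?d = "\<lambda>\<omega>. (exp (Y \<omega> / 2) - exp (- (Y \<omega> / 2)))\<^sup>2"
  have eq: "ennreal (exp (1 * Y \<omega>)) + ennreal (exp ((- 1) * Y \<omega>)) = 2 + ennreal (?d \<omega>)" for \<omega>
  proof -
    have "exp (Y \<omega>) + exp (- Y \<omega>) = 2 + ?d \<omega>"
    proof -
      have "exp (Y \<omega>) = (exp (Y \<omega> / 2))\<^sup>2" "exp (- Y \<omega>) = (exp (- (Y \<omega> / 2)))\<^sup>2"
        "exp (Y \<omega> / 2) * exp (- (Y \<omega> / 2)) = 1"
        by (simp_all add: exp_double[symmetric] exp_add[symmetric])
      thus ?thesis by (simp only: power2_diff mult.assoc)
    qed
    thus ?thesis
      by (simp add: ennreal_plus[symmetric] del: ennreal_plus) (simp flip: ennreal_numeral)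
  qed
  have "2 + (\<integral>\<^sup>+\<omega>. ennreal (?d \<omega>) \<partial>M) = (\<integral>\<^sup>+\<omega>. 2 + ennreal (?d \<omega>) \<partial>M)"
    by (subst nn_integral_add) (auto simp: emeasure_space_1)
  also have "\<dots> = (\<integral>\<^sup>+\<omega>. ennreal (exp (1 * Y \<omega>)) \<partial>M) + (\<integral>\<^sup>+\<omega>. ennreal (exp ((- 1) * Y \<omega>)) \<partial>M)"
    unfolding eq[symmetric] by (rule nn_integral_add) measurable
  also have "\<dots> \<le> 1 + 1"
    by (intro add_mono le)
  finally have "2 + (\<integral>\<^sup>+\<omega>. ennreal (?d \<omega>) \<partial>M) \<le> 2 + 0"
    by simp
  hence "(\<integral>\<^sup>+\<omega>. ennreal (?d \<omega>) \<partial>M) \<le> 0"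
    by (subst (asm) ennreal_add_left_cancel_le) auto
  hence "(\<integral>\<^sup>+\<omega>. ennreal (?d \<omega>) \<partial>M) = 0"
    by simp
  hence "AE \<omega> in M. ennreal (?d \<omega>) = 0"
    by (subst (asm) nn_integral_0_iff_AE) auto
  thus ?thesis
    by eventually_elim simp
qed

section \<open>Tails of integral functionals\<close>

text \<open>
  The elementary inequality behind the tail bound. Bernoulli's inequality for the exponent
  \<open>s / p \<ge> 1\<close> gives \<open>1 + (s / p) (w\<^sup>p - 1) \<le> w\<^sup>s\<close>, and \<open>w\<^sup>s \<le> e\<^sup>s\<^sup>(\<^sup>w\<^sup>-\<^sup>1\<^sup>)\<close> because
  \<open>ln w \<le> w - 1\<close>. The terms are arranged so that both sides are sums of nonnegative functions
  and can be integrated separately.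
\<close>

lemma power_lower_bound_exp:
  fixes p s w :: real
  assumes "0 < p" "p \<le> s" "0 \<le> w"
  shows "1 + s / p * w powr p \<le> exp (s * (w - 1)) + s / p"
proof (cases "w = 0")
  case True
  have "1 \<le> s / p"
    using assms by simp
  thus ?thesis
    using True by (simp add: add_increasing)
next
  case False
  hence w: "w > 0" using assms by simp
  \<comment> \<open>Bernoulli's inequality, as convexity of \<open>exp\<close> between \<open>0\<close> and \<open>s ln w\<close>.\<close>
  have "exp ((1 - p / s) *\<^sub>R 0 + (p / s) *\<^sub>R (s * ln w)) \<le> (1 - p / s) * exp 0 + p / s * exp (s * ln w)"
    using assms by (intro convex_onD[OF exp_convex]) auto
  hence "w powr p \<le> 1 - p / s + p / s * exp (s * ln w)"
    using assms w by (simp add: powr_def)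
  also have "\<dots> \<le> 1 - p / s + p / s * exp (s * (w - 1))"
    using assms w ln_le_minus_one[of w] by (intro add_left_mono mult_left_mono) auto
  finally have "s / p * w powr p \<le> s / p * (1 - p / s + p / s * exp (s * (w - 1)))"
    using assms by (intro mult_left_mono) auto
  also have "\<dots> = s / p - 1 + exp (s * (w - 1))"
    using assms by (simp add: field_simps)
  finally show ?thesis by simp
qed

lemma (in prob_space) exp_abs_mgf_le:
  assumes [measurable]: "Y \<in> borel_measurable M"
    and mgf: "\<And>u. (\<integral>\<^sup>+\<omega>. ennreal (exp (u * Y \<omega>)) \<partial>M) \<le> ennreal (exp (\<phi> (u * \<sigma>)))"
    and even: "\<And>u::real. \<phi> (- u) = \<phi> u" and "\<sigma> \<noteq> 0"
  shows "(\<integral>\<^sup>+\<omega>. ennreal (exp (v * \<bar>Y \<omega>\<bar> / \<sigma>)) \<partial>M) \<le> ennreal (2 * exp (\<phi> v))"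
proof -
  have "(\<integral>\<^sup>+\<omega>. ennreal (exp (v * \<bar>Y \<omega>\<bar> / \<sigma>)) \<partial>M) \<le>
          (\<integral>\<^sup>+\<omega>. ennreal (exp (v / \<sigma> * Y \<omega>)) + ennreal (exp ((- (v / \<sigma>)) * Y \<omega>)) \<partial>M)"
    by (intro nn_integral_mono) (auto simp: abs_if)
  also have "\<dots> = (\<integral>\<^sup>+\<omega>. ennreal (exp (v / \<sigma> * Y \<omega>)) \<partial>M) + (\<integral>\<^sup>+\<omega>. ennreal (exp ((- (v / \<sigma>)) * Y \<omega>)) \<partial>M)"
    by (rule nn_integral_add) measurable
  also have "\<dots> \<le> ennreal (exp (\<phi> (v / \<sigma> * \<sigma>))) + ennreal (exp (\<phi> (- (v / \<sigma>) * \<sigma>)))"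
    by (intro add_mono mgf)
  also have "\<dots> = ennreal (2 * exp (\<phi> v))"
    using \<open>\<sigma> \<noteq> 0\<close> even[of v] by (simp flip: ennreal_plus)
  finally show ?thesis .
qed

text \<open>
  Where \<open>\<sigma>\<close> vanishes one cannot normalise by it, but there \<open>Y\<close> vanishes as well. Fubini's theorem
  turns "for almost every \<open>t\<close>, almost surely" into "almost surely, for almost every \<open>t\<close>".
\<close>

lemma (in prob_space) AE_zero_where_degenerate:
  assumes "sigma_finite_measure N"
    and [measurable]: "(\<lambda>(t, \<omega>). Y t \<omega>) \<in> borel_measurable (N \<Otimes>\<^sub>M M)" "\<sigma> \<in> borel_measurable N"
    and mgf: "AE t in N. \<forall>u. (\<integral>\<^sup>+\<omega>. ennreal (exp (u * Y t \<omega>)) \<partial>M) \<le> ennreal (exp (\<phi> (u * \<sigma> t)))"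
    and "\<phi> 0 = (0::real)"
  shows "AE \<omega> in M. AE t in N. \<sigma> t = (0::real) \<longrightarrow> Y t \<omega> = 0"
proof -
  interpret N: sigma_finite_measure N by fact
  interpret P: pair_sigma_finite N M
    by (intro pair_sigma_finite.intro sigma_finite_measure_axioms N.sigma_finite_measure_axioms)
  have "AE t in N. AE \<omega> in M. \<sigma> t = 0 \<longrightarrow> Y t \<omega> = 0"
    using mgf AE_space
  proof eventually_elim
    case (elim t)
    have [measurable]: "Y t \<in> borel_measurable M"
      using elim(2) by measurable
    show ?case
    proof (cases "\<sigma> t = 0")
      case True
      with elim(1) \<open>\<phi> 0 = 0\<close> have "AE \<omega> in M. Y t \<omega> = 0"
        by (intro AE_zero_if_mgf_le_1) auto
      thus ?thesis by eventually_elim simp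
    qed simp
  qed
  thus ?thesis
    by (subst (asm) P.AE_commute) auto
qed

text \<open>
  Put \<open>s = v x\<close> and \<open>W = |Y| / (\<sigma> x)\<close>. If the integral \<open>Q\<close> of \<open>|Y|\<^sup>p\<close> exceeds \<open>\<delta> = c x\<^sup>p\<close>, then
  \<open>W\<^sup>p\<close> has mean above \<open>1\<close> under the probability measure \<open>\<sigma>\<^sup>p dt / c\<close>, and by the elementary inequality
  above so has \<open>exp (s (W - 1)) = exp (v |Y| / \<sigma> - s)\<close>; this needs \<open>s \<ge> p\<close>. By Fubini's theorem the
  expectation of that mean is at most \<open>2 exp (\<phi>(v) - s)\<close>, and Markov's inequality concludes.
  The function \<open>G\<close> in the proof is the integrand \<open>\<sigma>\<^sup>p exp (v |Y| / \<sigma> - s)\<close>.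
\<close>

lemma (in prob_space) Lp_tail_bound:
  fixes Y :: "'t \<Rightarrow> 'a \<Rightarrow> real" and \<sigma> :: "'t \<Rightarrow> real" and \<phi> :: "real \<Rightarrow> real"
  assumes "sigma_finite_measure N"
    and Y [measurable]: "(\<lambda>(t, \<omega>). Y t \<omega>) \<in> borel_measurable (N \<Otimes>\<^sub>M M)"
    and \<sigma> [measurable]: "\<sigma> \<in> borel_measurable N" and \<sigma>_nonneg: "\<And>t. 0 \<le> \<sigma> t"
    and mgf: "AE t in N. \<forall>u. (\<integral>\<^sup>+\<omega>. ennreal (exp (u * Y t \<omega>)) \<partial>M) \<le> ennreal (exp (\<phi> (u * \<sigma> t)))"
    and \<phi>0: "\<phi> 0 = 0" and even: "\<And>u. \<phi> (- u) = \<phi> u"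
    and c: "(\<integral>\<^sup>+t. ennreal (\<sigma> t powr p) \<partial>N) = ennreal c" "0 < c"
    and "0 < p" "0 < \<delta>" and x: "0 < x" "x powr p = \<delta> / c" and v: "p \<le> v * x"
  shows "emeasure M {\<omega> \<in> space M. (\<integral>\<^sup>+t. ennreal (\<bar>Y t \<omega>\<bar> powr p) \<partial>N) > ennreal \<delta>} \<le>
           ennreal (2 * exp (\<phi> v - v * x))"
proof -
  interpret N: sigma_finite_measure N by fact
  interpret P: pair_sigma_finite N M
    by (intro pair_sigma_finite.intro sigma_finite_measure_axioms N.sigma_finite_measure_axioms)
  define s where "s = v * x"
  have s: "0 < s" "p \<le> s"
    using v \<open>0 < p\<close> by (auto simp: s_def)
  define Q where "Q \<omega> = (\<integral>\<^sup>+t. ennreal (\<bar>Y t \<omega>\<bar> powr p) \<partial>N)" for \<omega>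
  define G where "G t \<omega> = ennreal (\<sigma> t powr p * exp (v * \<bar>Y t \<omega>\<bar> / \<sigma> t - s))" for t \<omega>
  have [measurable]: "(\<lambda>(t, \<omega>). G t \<omega>) \<in> borel_measurable (N \<Otimes>\<^sub>M M)"
    unfolding G_def by measurable
  have [measurable]: "(\<lambda>(\<omega>, t). G t \<omega>) \<in> borel_measurable (M \<Otimes>\<^sub>M N)"
    using measurable_compose[OF measurable_pair_swap', of "\<lambda>(t, \<omega>). G t \<omega>" N M borel]
    by (simp add: case_prod_unfold)
  have [measurable]: "(\<lambda>(\<omega>, t). Y t \<omega>) \<in> borel_measurable (M \<Otimes>\<^sub>M N)"
    using measurable_compose[OF measurable_pair_swap' Y]
    by (simp add: case_prod_unfold)
  have [measurable]: "Q \<in> borel_measurable M"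
    unfolding Q_def by measurable

  have pointwise: "ennreal (\<sigma> t powr p) + ennreal (s / p * c / \<delta>) * ennreal (\<bar>Y t \<omega>\<bar> powr p) \<le>
      G t \<omega> + ennreal (s / p) * ennreal (\<sigma> t powr p)" if "\<sigma> t = 0 \<longrightarrow> Y t \<omega> = 0" for t \<omega>
  proof (cases "\<sigma> t = 0")
    case False
    hence \<sigma>t: "\<sigma> t > 0" using \<sigma>_nonneg[of t] by simp
    define w where "w = \<bar>Y t \<omega>\<bar> / (\<sigma> t * x)"
    have "1 + s / p * w powr p \<le> exp (s * (w - 1)) + s / p"
      using s \<open>0 < p\<close> \<sigma>t x by (intro power_lower_bound_exp) (auto simp: w_def)
    moreover have "s * (w - 1) = v * \<bar>Y t \<omega>\<bar> / \<sigma> t - s"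
      using \<sigma>t x by (simp add: w_def s_def field_simps)
    ultimately have "\<sigma> t powr p * (1 + s / p * w powr p) \<le> \<sigma> t powr p * (exp (v * \<bar>Y t \<omega>\<bar> / \<sigma> t - s) + s / p)"
      by (intro mult_left_mono) auto
    moreover have "\<sigma> t powr p * w powr p = c / \<delta> * \<bar>Y t \<omega>\<bar> powr p"
      using \<sigma>t x c \<open>0 < \<delta>\<close> by (simp add: w_def powr_divide powr_mult)
    hence "\<sigma> t powr p * (1 + s / p * w powr p) = \<sigma> t powr p + s / p * c / \<delta> * \<bar>Y t \<omega>\<bar> powr p"
      by (simp add: algebra_simps)
    ultimately have "\<sigma> t powr p + s / p * c / \<delta> * \<bar>Y t \<omega>\<bar> powr p \<le>
        \<sigma> t powr p * exp (v * \<bar>Y t \<omega>\<bar> / \<sigma> t - s) + s / p * \<sigma> t powr p"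
      by (simp add: algebra_simps)
    thus ?thesis
      unfolding G_def using s c \<open>0 < p\<close> \<open>0 < \<delta>\<close>
      by (simp add: ennreal_mult[symmetric] ennreal_plus[symmetric] del: ennreal_plus)
  qed (use that in simp)

  have exceed: "AE \<omega> in M. Q \<omega> > ennreal \<delta> \<longrightarrow> ennreal c \<le> (\<integral>\<^sup>+t. G t \<omega> \<partial>N)"
    using AE_zero_where_degenerate[OF assms(1) Y \<sigma> mgf \<phi>0] AE_space
  proof eventually_elim
    case (elim \<omega>)
    have [measurable]: "(\<lambda>t. Y t \<omega>) \<in> borel_measurable N" "(\<lambda>t. G t \<omega>) \<in> borel_measurable N"
      using elim(2) by measurable
    have integrated: "(\<integral>\<^sup>+t. ennreal (\<sigma> t powr p) + ennreal (s / p * c / \<delta>) * ennreal (\<bar>Y t \<omega>\<bar> powr p) \<partial>N) \<le>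
        (\<integral>\<^sup>+t. G t \<omega> + ennreal (s / p) * ennreal (\<sigma> t powr p) \<partial>N)"
      by (rule nn_integral_mono_AE) (rule eventually_mono[OF elim(1) pointwise])
    have le: "ennreal c + ennreal (s / p * c / \<delta>) * Q \<omega> \<le> (\<integral>\<^sup>+t. G t \<omega> \<partial>N) + ennreal (s / p * c)"
    proof -
      have "ennreal (s / p * c) = ennreal (s / p) * ennreal c"
        using s c \<open>0 < p\<close> by (intro ennreal_mult) auto
      thus ?thesis
        using integrated by (simp add: nn_integral_add nn_integral_cmult Q_def c(1))
    qed
    show ?case
    proof
      assume "Q \<omega> > ennreal \<delta>"
      hence "ennreal (s / p * c / \<delta>) * ennreal \<delta> \<le> ennreal (s / p * c / \<delta>) * Q \<omega>"
        by (intro mult_left_mono) auto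
      moreover have "ennreal (s / p * c) = ennreal (s / p * c / \<delta>) * ennreal \<delta>"
        using s c \<open>0 < p\<close> \<open>0 < \<delta>\<close> by (subst ennreal_mult[symmetric]) auto
      ultimately have "ennreal (s / p * c) \<le> ennreal (s / p * c / \<delta>) * Q \<omega>"
        by simp
      from order_trans[OF add_left_mono[OF this] le]
      have "ennreal c + ennreal (s / p * c) \<le> (\<integral>\<^sup>+t. G t \<omega> \<partial>N) + ennreal (s / p * c)" .
      thus "ennreal c \<le> (\<integral>\<^sup>+t. G t \<omega> \<partial>N)"
        by (simp add: add.commute[of _ "ennreal (s / p * c)"] ennreal_add_left_cancel_le)
    qed
  qed

  have G_mean: "AE t in N. (\<integral>\<^sup>+\<omega>. G t \<omega> \<partial>M) \<le> ennreal (2 * exp (\<phi> v - s)) * ennreal (\<sigma> t powr p)"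
    using mgf AE_space
  proof eventually_elim
    case (elim t)
    have [measurable]: "Y t \<in> borel_measurable M"
      using elim(2) by measurable
    show ?case
    proof (cases "\<sigma> t = 0")
      case False
      have "G t \<omega> = ennreal (\<sigma> t powr p * exp (- s)) * ennreal (exp (v * \<bar>Y t \<omega>\<bar> / \<sigma> t))" for \<omega>
        unfolding G_def
        by (subst ennreal_mult[symmetric]) (simp_all only: diff_conv_add_uminus exp_add mult_ac, auto)
      hence "(\<integral>\<^sup>+\<omega>. G t \<omega> \<partial>M) =
          (\<integral>\<^sup>+\<omega>. ennreal (\<sigma> t powr p * exp (- s)) * ennreal (exp (v * \<bar>Y t \<omega>\<bar> / \<sigma> t)) \<partial>M)"
        by simp
      also have "\<dots> = ennreal (\<sigma> t powr p * exp (- s)) * (\<integral>\<^sup>+\<omega>. ennreal (exp (v * \<bar>Y t \<omega>\<bar> / \<sigma> t)) \<partial>M)"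
        by (rule nn_integral_cmult) measurable
      also have "\<dots> \<le> ennreal (\<sigma> t powr p * exp (- s)) * ennreal (2 * exp (\<phi> v))"
        using elim(1) False by (intro mult_left_mono exp_abs_mgf_le even) auto
      also have "\<dots> = ennreal (2 * exp (\<phi> v - s)) * ennreal (\<sigma> t powr p)"
        by (subst (1 2) ennreal_mult[symmetric]) (auto simp: exp_diff exp_minus field_simps)
      finally show ?thesis .
    qed (simp add: G_def)
  qed

  have "(\<integral>\<^sup>+\<omega>. (\<integral>\<^sup>+t. G t \<omega> \<partial>N) \<partial>M) = (\<integral>\<^sup>+t. (\<integral>\<^sup>+\<omega>. G t \<omega> \<partial>M) \<partial>N)"
    by (rule P.Fubini') measurable
  also have "\<dots> \<le> (\<integral>\<^sup>+t. ennreal (2 * exp (\<phi> v - s)) * ennreal (\<sigma> t powr p) \<partial>N)"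
    by (rule nn_integral_mono_AE[OF G_mean])
  also have "\<dots> = ennreal (2 * exp (\<phi> v - s)) * ennreal c"
    by (subst nn_integral_cmult) (auto simp: c(1))
  finally have total_mean: "(\<integral>\<^sup>+\<omega>. (\<integral>\<^sup>+t. G t \<omega> \<partial>N) \<partial>M) \<le> ennreal (2 * exp (\<phi> v - s)) * ennreal c" .

  have "emeasure M {\<omega> \<in> space M. Q \<omega> > ennreal \<delta>} \<le>
          emeasure M {\<omega> \<in> space M. 1 \<le> ennreal (1 / c) * (\<integral>\<^sup>+t. G t \<omega> \<partial>N)}"
  proof (rule emeasure_mono_AE)
    show "AE \<omega> in M. \<omega> \<in> {\<omega> \<in> space M. Q \<omega> > ennreal \<delta>} \<longrightarrow>
        \<omega> \<in> {\<omega> \<in> space M. 1 \<le> ennreal (1 / c) * (\<integral>\<^sup>+t. G t \<omega> \<partial>N)}"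
      using exceed
    proof eventually_elim
      case (elim \<omega>)
      have "1 = ennreal (1 / c) * ennreal c"
        using c by (simp flip: ennreal_mult)
      with elim mult_left_mono[of "ennreal c" "\<integral>\<^sup>+t. G t \<omega> \<partial>N" "ennreal (1 / c)"] show ?case
        by auto
    qed
  qed measurable
  also have "\<dots> \<le> ennreal (1 / c) * (\<integral>\<^sup>+\<omega>. (\<integral>\<^sup>+t. G t \<omega> \<partial>N) * indicator (space M) \<omega> \<partial>M)"
    by (rule nn_integral_Markov_inequality) measurable
  also have "(\<integral>\<^sup>+\<omega>. (\<integral>\<^sup>+t. G t \<omega> \<partial>N) * indicator (space M) \<omega> \<partial>M) = (\<integral>\<^sup>+\<omega>. (\<integral>\<^sup>+t. G t \<omega> \<partial>N) \<partial>M)"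
    by (intro nn_integral_cong) simp
  also have "ennreal (1 / c) * \<dots> \<le> ennreal (1 / c) * (ennreal (2 * exp (\<phi> v - s)) * ennreal c)"
    by (rule mult_left_mono[OF total_mean]) simp
  also have "\<dots> = ennreal (2 * exp (\<phi> v - s))"
    using c by (simp flip: ennreal_mult)
  finally show ?thesis
    unfolding Q_def s_def .
qed

lemma (in prob_space) Lp_tail_degenerate:
  fixes Y :: "'t \<Rightarrow> 'a \<Rightarrow> real" and \<sigma> :: "'t \<Rightarrow> real"
  assumes "sigma_finite_measure N"
    and Y: "(\<lambda>(t, \<omega>). Y t \<omega>) \<in> borel_measurable (N \<Otimes>\<^sub>M M)"
    and \<sigma> [measurable]: "\<sigma> \<in> borel_measurable N"
    and mgf: "AE t in N. \<forall>u. (\<integral>\<^sup>+\<omega>. ennreal (exp (u * Y t \<omega>)) \<partial>M) \<le> ennreal (exp (\<phi> (u * \<sigma> t)))"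
    and \<phi>0: "\<phi> 0 = 0"
    and c: "(\<integral>\<^sup>+t. ennreal (\<sigma> t powr p) \<partial>N) = 0"
  shows "emeasure M {\<omega> \<in> space M. (\<integral>\<^sup>+t. ennreal (\<bar>Y t \<omega>\<bar> powr p) \<partial>N) > ennreal \<delta>} = 0"
proof -
  have \<sigma>0: "AE t in N. \<sigma> t = 0"
    using c by (subst (asm) nn_integral_0_iff_AE) auto
  have "AE \<omega> in M. (\<integral>\<^sup>+t. ennreal (\<bar>Y t \<omega>\<bar> powr p) \<partial>N) = 0"
    using AE_zero_where_degenerate[OF assms(1) Y \<sigma> mgf \<phi>0]
  proof eventually_elim
    case (elim \<omega>)
    with \<sigma>0 have "AE t in N. ennreal (\<bar>Y t \<omega>\<bar> powr p) = 0"
      by eventually_elim simp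
    hence "(\<integral>\<^sup>+t. ennreal (\<bar>Y t \<omega>\<bar> powr p) \<partial>N) = (\<integral>\<^sup>+t. 0 \<partial>N)"
      by (rule nn_integral_cong_AE)
    thus ?case by simp
  qed
  hence "AE \<omega> in M. \<not> ennreal \<delta> < (\<integral>\<^sup>+t. ennreal (\<bar>Y t \<omega>\<bar> powr p) \<partial>N)"
    by eventually_elim simp
  thus ?thesis
    by (simp add: AE_iff_null_sets null_setsD1 emeasure_eq_0_AE)
qed

section \<open>Orthonormal expansions of random variables\<close>

lemma integrable_square_diff_sum:
  fixes X :: "'a \<Rightarrow> real" and \<xi> :: "nat \<Rightarrow> 'a \<Rightarrow> real"
  assumes [measurable]: "X \<in> borel_measurable M" "\<And>j. \<xi> j \<in> borel_measurable M"
    and X2: "integrable M (\<lambda>\<omega>. (X \<omega>)\<^sup>2)" and \<xi>2: "\<And>j. integrable M (\<lambda>\<omega>. (\<xi> j \<omega>)\<^sup>2)"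
  shows "integrable M (\<lambda>\<omega>. (X \<omega> - (\<Sum>j\<le>n. a j * \<xi> j \<omega>))\<^sup>2)"
proof -
  have diff: "integrable M (\<lambda>\<omega>. (U \<omega> - r * V \<omega>)\<^sup>2)"
    if [measurable]: "U \<in> borel_measurable M" "V \<in> borel_measurable M"
      and int: "integrable M (\<lambda>\<omega>. (U \<omega>)\<^sup>2)" "integrable M (\<lambda>\<omega>. (V \<omega>)\<^sup>2)"
    for U V :: "'a \<Rightarrow> real" and r
  proof (rule Bochner_Integration.integrable_bound)
    show "integrable M (\<lambda>\<omega>. 2 * (U \<omega>)\<^sup>2 + 2 * r\<^sup>2 * (V \<omega>)\<^sup>2)"
      using int by simp
    have "(x - r * y)\<^sup>2 \<le> 2 * x\<^sup>2 + 2 * r\<^sup>2 * y\<^sup>2" for x y :: real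
      using zero_le_power2[of "x + r * y"] by (simp add: power2_diff power2_sum power_mult_distrib)
    thus "AE \<omega> in M. norm ((U \<omega> - r * V \<omega>)\<^sup>2) \<le> norm (2 * (U \<omega>)\<^sup>2 + 2 * r\<^sup>2 * (V \<omega>)\<^sup>2)"
      by simp
  qed measurable
  have "integrable M (\<lambda>\<omega>. (X \<omega> - (\<Sum>j<n. a j * \<xi> j \<omega>))\<^sup>2)" for n
  proof (induction n)
    case (Suc n)
    have "integrable M (\<lambda>\<omega>. ((X \<omega> - (\<Sum>j<n. a j * \<xi> j \<omega>)) - a n * \<xi> n \<omega>)\<^sup>2)"
      by (rule diff[OF _ _ Suc \<xi>2]) measurable
    thus ?case by (simp add: algebra_simps)
  qed (use X2 in simp)
  from this[of "Suc n"] show ?thesis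
    by (simp only: lessThan_Suc_atMost)
qed

text \<open>
  For \<open>n \<ge> k\<close> the moment of the remainder \<open>X - S\<^sub>n\<close> with \<open>\<xi>\<^sub>k\<close> equals \<open>E X \<xi>\<^sub>k - a\<^sub>k\<close>, and Bessel's
  inequality bounds its square by the mean square of the remainder, which tends to zero. The
  formula is what makes the coefficient functions measurable in \<open>t\<close>: the right-hand side is an
  integral of the jointly measurable process.
\<close>

lemma orthonormal_coefficient_as_moment:
  fixes \<xi> :: "nat \<Rightarrow> 'a \<Rightarrow> real"
  assumes [measurable]: "X \<in> borel_measurable M" "\<And>j. \<xi> j \<in> borel_measurable M"
    and X2: "integrable M (\<lambda>\<omega>. (X \<omega>)\<^sup>2)" and \<xi>2: "\<And>j. integrable M (\<lambda>\<omega>. (\<xi> j \<omega>)\<^sup>2)"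
    and orth: "\<And>k l. (\<integral>\<omega>. \<xi> k \<omega> * \<xi> l \<omega> \<partial>M) = (if k = l then 1 else 0)"
    and S2: "\<And>n. integrable M (\<lambda>\<omega>. (X \<omega> - (\<Sum>j\<le>n. a j * \<xi> j \<omega>))\<^sup>2)"
    and lim: "(\<lambda>n. \<integral>\<omega>. (X \<omega> - (\<Sum>j\<le>n. a j * \<xi> j \<omega>))\<^sup>2 \<partial>M) \<longlonglongrightarrow> 0"
  shows "a k = (\<integral>\<omega>. X \<omega> * \<xi> k \<omega> \<partial>M)"
proof -
  have unit: "(\<integral>\<omega>. (\<xi> j \<omega>)\<^sup>2 \<partial>M) = 1" for j
    using orth[of j j] by (simp add: power2_eq_square)
  have prods: "integrable M (\<lambda>\<omega>. X \<omega> * \<xi> j \<omega>)" "integrable M (\<lambda>\<omega>. \<xi> j \<omega> * \<xi> l \<omega>)" for j l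
    using X2 \<xi>2 unit by (intro integral_unit_square_Bessel(1); simp)+
  let ?m = "(\<integral>\<omega>. X \<omega> * \<xi> k \<omega> \<partial>M)"
  have le: "(?m - a k)\<^sup>2 \<le> (\<integral>\<omega>. (X \<omega> - (\<Sum>j\<le>n. a j * \<xi> j \<omega>))\<^sup>2 \<partial>M)" if "n \<ge> k" for n
  proof -
    have "(\<integral>\<omega>. (X \<omega> - (\<Sum>j\<le>n. a j * \<xi> j \<omega>)) * \<xi> k \<omega> \<partial>M) =
            (\<integral>\<omega>. X \<omega> * \<xi> k \<omega> - (\<Sum>j\<le>n. a j * (\<xi> j \<omega> * \<xi> k \<omega>)) \<partial>M)"
      by (simp add: left_diff_distrib sum_distrib_right mult.assoc)
    also have "\<dots> = ?m - (\<Sum>j\<le>n. a j * (\<integral>\<omega>. \<xi> j \<omega> * \<xi> k \<omega> \<partial>M))"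
      using prods by simp
    also have "\<dots> = ?m - a k"
      using that by (simp add: orth if_distrib[of "\<lambda>x. _ * x"] cong: if_cong)
    finally show ?thesis
      using integral_unit_square_Bessel(2)[of "\<lambda>\<omega>. X \<omega> - (\<Sum>j\<le>n. a j * \<xi> j \<omega>)" M "\<xi> k"] S2[of n] \<xi>2[of k] unit[of k]
      by simp
  qed
  have "(?m - a k)\<^sup>2 \<le> 0"
    by (rule LIMSEQ_le_const[OF lim]) (use le in blast)
  thus ?thesis by simp
qed

text \<open>
  The squared norms \<open>\<tau>\<^sup>2(\<xi>\<^sub>k) b\<^sub>k\<^sup>2\<close> of the terms add up to a bound on the squared norm of the sum of the
  series. The partial sums start at \<open>N\<close>, the order from which on they contain all corrected
  coefficients of the model.
\<close>

lemma mgf_le_of_expansion: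
  fixes \<xi> :: "nat \<Rightarrow> 'w \<Rightarrow> real" and b :: "nat \<Rightarrow> real"
  assumes "prob_space M" "\<gamma> > 2"
    and indep: "prob_space.indep_vars M (\<lambda>_. borel) \<xi> UNIV"
    and sub: "\<And>k. \<xi> k \<in> Sub M (phi \<gamma>)"
    and Y [measurable]: "Y \<in> borel_measurable M"
    and int: "\<And>n. integrable M (\<lambda>\<omega>. (Y \<omega> - (\<Sum>k\<le>N + n. b k * \<xi> k \<omega>))\<^sup>2)"
    and lim: "(\<lambda>n. \<integral>\<omega>. (Y \<omega> - (\<Sum>k\<le>N + n. b k * \<xi> k \<omega>))\<^sup>2 \<partial>M) \<longlonglongrightarrow> 0"
    and fin: "(\<Sum>k. ennreal ((sub_norm M (phi \<gamma>) (\<xi> k))\<^sup>2 * (b k)\<^sup>2)) < \<top>"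
  shows "(\<integral>\<^sup>+\<omega>. ennreal (exp (u * Y \<omega>)) \<partial>M) \<le>
           ennreal (exp (phi \<gamma> (u * sqrt (enn2real (\<Sum>k. ennreal ((sub_norm M (phi \<gamma>) (\<xi> k))\<^sup>2 * (b k)\<^sup>2))))))"
    (is "_ \<le> ennreal (exp (phi \<gamma> (u * sqrt (enn2real ?S))))")
proof -
  interpret prob_space M by fact
  let ?v = "\<lambda>k. (sub_norm M (phi \<gamma>) (\<xi> k))\<^sup>2 * (b k)\<^sup>2"
  have [measurable]: "\<xi> k \<in> borel_measurable M" for k
    using sub[of k] by (auto simp: Sub_def centered_def)
  show ?thesis
  proof (rule mgf_le_of_L2_limit[OF Y _ int lim])
    fix n
    have "ennreal (\<Sum>k\<le>N + n. ?v k) = (\<Sum>k\<le>N + n. ennreal (?v k))"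
      by (simp add: sum_ennreal)
    also have "\<dots> \<le> ?S"
      by (rule sum_le_suminf) auto
    finally have "(\<Sum>k\<le>N + n. ?v k) \<le> enn2real ?S"
      using fin enn2real_mono[of "ennreal (\<Sum>k\<le>N + n. ?v k)" ?S] by (simp add: sum_nonneg)
    hence le: "\<bar>u * sqrt (\<Sum>k\<le>N + n. ?v k)\<bar> \<le> \<bar>u * sqrt (enn2real ?S)\<bar>"
      by (simp add: abs_mult mult_left_mono sum_nonneg)
    have "(\<integral>\<^sup>+\<omega>. ennreal (exp (u * (\<Sum>k\<le>N + n. b k * \<xi> k \<omega>))) \<partial>M) \<le>
        ennreal (exp (phi \<gamma> (u * sqrt (\<Sum>k\<le>N + n. ?v k))))"
      by (rule mgf_indep_sum_le[OF \<open>\<gamma> > 2\<close> indep_vars_subset[OF indep] _ sub]) auto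
    also have "\<dots> \<le> ennreal (exp (phi \<gamma> (u * sqrt (enn2real ?S))))"
      using phi_mono[OF \<open>\<gamma> > 2\<close> le] by (intro ennreal_leI) simp
    finally show "(\<integral>\<^sup>+\<omega>. ennreal (exp (u * (\<Sum>k\<le>N + n. b k * \<xi> k \<omega>))) \<partial>M) \<le>
        ennreal (exp (phi \<gamma> (u * sqrt (enn2real ?S))))" .
  qed measurable
qed

section \<open>Reliability and accuracy of the model\<close>

lemma epowr_mono:
  assumes "x \<le> y" "0 \<le> r"
  shows "epowr x r \<le> epowr y r"
proof (cases "y = \<top>")
  case False
  with assms have "enn2real x powr r \<le> enn2real y powr r"
    by (intro powr_mono2 enn2real_mono) (auto simp: top.not_eq_extremum)
  thus ?thesis
    using False assms by (auto simp: epowr_def top_unique intro: ennreal_leI)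
qed (simp add: epowr_def)

lemma borel_measurable_epowr [measurable]: "(\<lambda>x. epowr x r) \<in> borel_measurable borel"
  unfolding epowr_def by measurable

text \<open>
  The value \<open>v = x\<^sup>\<beta>\<^sup>-\<^sup>1\<close> maximises \<open>v x - \<phi>(v)\<close> when \<open>x \<ge> 1\<close>, with maximum \<open>x\<^sup>\<beta> / \<beta>\<close>, and then
  \<open>v x = x\<^sup>\<beta>\<close>. For \<open>x\<^sup>p = \<delta> / c\<close> the two hypotheses on \<open>c\<close> become \<open>x\<^sup>\<beta> \<ge> \<beta> ln (2 / \<alpha>)\<close>, which makes
  the tail bound at most \<open>\<alpha>\<close>, and \<open>x\<^sup>\<beta> > p\<close>, which makes the tail bound applicable.
\<close>

lemma optimal_exponent:
  assumes "\<gamma> > 2" and \<beta>: "1 / \<gamma> + 1 / \<beta> = 1" and "p \<ge> 1" "\<delta> > 0" "0 < \<alpha>" "\<alpha> < 1" "0 < c"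
    and c1: "c \<le> \<delta> / (\<beta> * ln (2 / \<alpha>)) powr (p / \<beta>)"
    and c2: "c < \<delta> / p powr (p * (1 - 1 / \<gamma>))"
  obtains x v where "0 < x" "x powr p = \<delta> / c" "p \<le> v * x" "2 * exp (phi \<gamma> v - v * x) \<le> \<alpha>"
proof -
  have \<beta>_eq: "\<beta> = \<gamma> / (\<gamma> - 1)"
  proof -
    have "\<beta> \<noteq> 0"
      using \<beta> \<open>\<gamma> > 2\<close> by auto
    thus ?thesis
      using \<beta> \<open>\<gamma> > 2\<close> by (simp add: field_simps)
  qed
  have "\<beta> > 1" and inv: "1 - 1 / \<gamma> = 1 / \<beta>" and conj: "(\<beta> - 1) * \<gamma> = \<beta>"
    using \<open>\<gamma> > 2\<close> by (auto simp: \<beta>_eq field_simps)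
  define L where "L = \<beta> * ln (2 / \<alpha>)"
  have "L > 0"
    using \<open>\<beta> > 1\<close> assms by (simp add: L_def)
  define x where "x = (\<delta> / c) powr (1 / p)"
  have "x > 0"
    using assms by (simp add: x_def)
  have xp: "x powr p = \<delta> / c"
    using assms by (simp add: x_def powr_powr)
  have x\<beta>: "x powr \<beta> = (\<delta> / c) powr (\<beta> / p)"
    by (simp add: x_def powr_powr)
  have lower: "r \<le> x powr \<beta>" if "r > 0" "c \<le> \<delta> / r powr (p / \<beta>)" for r
  proof -
    have "r powr (p / \<beta>) \<le> \<delta> / c"
      using that \<open>0 < c\<close> by (simp add: field_simps)
    hence "(r powr (p / \<beta>)) powr (\<beta> / p) \<le> x powr \<beta>"
      unfolding x\<beta> using \<open>p \<ge> 1\<close> \<open>\<beta> > 1\<close> by (intro powr_mono2) auto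
    thus ?thesis
      using that \<open>p \<ge> 1\<close> \<open>\<beta> > 1\<close> by (simp add: powr_powr)
  qed
  have ge_p: "p \<le> x powr \<beta>"
    using c2 \<open>p \<ge> 1\<close> by (intro lower) (auto simp: inv)
  have ge_L: "L \<le> x powr \<beta>"
    using c1 \<open>L > 0\<close> by (intro lower) (auto simp: L_def)
  have "x \<ge> 1"
  proof (rule ccontr)
    assume "\<not> x \<ge> 1"
    hence "x powr \<beta> < 1 powr \<beta>"
      using \<open>x > 0\<close> \<open>\<beta> > 1\<close> by (intro powr_less_mono2) auto
    thus False
      using ge_p \<open>p \<ge> 1\<close> by simp
  qed
  define v where "v = x powr (\<beta> - 1)"
  have "v \<ge> 1"
    using \<open>x \<ge> 1\<close> \<open>\<beta> > 1\<close> by (simp add: v_def ge_one_powr_ge_zero)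
  have vx: "v * x = x powr \<beta>"
    using \<open>x > 0\<close> powr_add[of x "\<beta> - 1" 1] by (simp add: v_def)
  have "phi \<gamma> v = x powr \<beta> / \<gamma>"
    using \<open>v \<ge> 1\<close> by (simp add: phi_def v_def powr_powr conj)
  hence "phi \<gamma> v - v * x = - (x powr \<beta> * (1 - 1 / \<gamma>))"
    by (simp add: vx algebra_simps)
  also have "\<dots> = - (x powr \<beta> / \<beta>)"
    by (simp add: inv)
  also have "\<dots> \<le> - (L / \<beta>)"
    using ge_L \<open>\<beta> > 1\<close> by (simp add: divide_right_mono)
  also have "\<dots> = - ln (2 / \<alpha>)"
    using \<open>\<beta> > 1\<close> by (simp add: L_def)
  finally have "2 * exp (phi \<gamma> v - v * x) \<le> 2 * exp (- ln (2 / \<alpha>))"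
    by simp
  also have "\<dots> = \<alpha>"
    using \<open>0 < \<alpha>\<close> by (simp add: exp_minus)
  finally show ?thesis
    using that[of x v] \<open>x > 0\<close> xp ge_p vx by simp
qed

theorem theorem3:
  fixes M :: "'w measure"
    and T p \<gamma> \<beta> \<alpha> \<delta> :: real
    and X :: "real \<Rightarrow> 'w \<Rightarrow> real"
    and f :: "real \<Rightarrow> real \<Rightarrow> real"
    and \<xi> :: "nat \<Rightarrow> 'w \<Rightarrow> real"
    and ahat :: "nat \<Rightarrow> real \<Rightarrow> real"
    and N :: nat
  assumes "prob_space M"
    and "T > 0" and "p \<ge> 1" and "\<gamma> > 2" and "1 / \<gamma> + 1 / \<beta> = 1"
    and X_measurable:
      "(\<lambda>(t, \<omega>). X t \<omega>) \<in> borel_measurable (lebesgue_on {0..T} \<Otimes>\<^sub>M M)"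
    and X_second_order: "\<And>t. t \<in> {0..T} \<Longrightarrow> integrable M (\<lambda>\<omega>. (X t \<omega>)\<^sup>2)"
    and X_centered: "\<And>t. t \<in> {0..T} \<Longrightarrow> centered M (X t)"
    and X_sub: "\<And>t. t \<in> {0..T} \<Longrightarrow> X t \<in> Sub M (phi \<gamma>)"
    and f_L2_measurable: "\<And>t. t \<in> {0..T} \<Longrightarrow> f t \<in> borel_measurable lborel"
    and f_L2: "\<And>t. t \<in> {0..T} \<Longrightarrow> integrable lborel (\<lambda>x. (f t x)\<^sup>2)"
    and X_correlation:
      "\<And>t s. t \<in> {0..T} \<Longrightarrow> s \<in> {0..T} \<Longrightarrow>
        (\<integral>\<omega>. X t \<omega> * X s \<omega> \<partial>M) = (\<integral>x. f t x * f s x \<partial>lborel)"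
    and xi_indep: "prob_space.indep_vars M (\<lambda>_. borel) \<xi> UNIV"
    and xi_sub: "\<And>k. \<xi> k \<in> Sub M (phi \<gamma>)"
    and xi_mean: "\<And>k. (\<integral>\<omega>. \<xi> k \<omega> \<partial>M) = 0"
    and xi_orthonormal:
      "\<And>k l. (\<integral>\<omega>. \<xi> k \<omega> * \<xi> l \<omega> \<partial>M) = (if k = l then 1 else 0)"
    and X_expansion:
      "\<And>t. t \<in> {0..T} \<Longrightarrow>
        (\<lambda>n. \<integral>\<omega>. (X t \<omega> - (\<Sum>k\<le>n. coeff_fun f k t * \<xi> k \<omega>))\<^sup>2 \<partial>M) \<longlonglongrightarrow> 0"
    and f_diff: "\<And>t x. t \<in> {0..T} \<Longrightarrow> f t differentiable (at x)"
    and f_diff2: "\<And>t x. t \<in> {0..T} \<Longrightarrow> deriv (f t) differentiable (at x)"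
    and f_bounded: "\<And>t. t \<in> {0..T} \<Longrightarrow> bounded (range (f t))"
    and Z_integrable: "\<And>t. t \<in> {0..T} \<Longrightarrow> integrable lborel (Z f t)"
    and ahat_measurable: "\<And>k. k \<le> N \<Longrightarrow> ahat k \<in> borel_measurable (lebesgue_on {0..T})"
    and c_finite: "c_const M T p \<gamma> f \<xi> ahat N < \<infinity>"
    and "0 < \<alpha>" and "\<alpha> < 1" and "\<delta> > 0"
    and c_bound1:
      "c_const M T p \<gamma> f \<xi> ahat N \<le> ennreal (\<delta> / (\<beta> * ln (2 / \<alpha>)) powr (p / \<beta>))"
    and c_bound2:
      "c_const M T p \<gamma> f \<xi> ahat N < ennreal (\<delta> / p powr (p * (1 - 1 / \<gamma>)))"
  shows "approximates_Lp M T p X (model \<xi> ahat N) \<alpha> \<delta>"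
proof -
  interpret prob_space M by fact
  let ?L = "lebesgue_on {0..T}"
  define \<tau> where "\<tau> k = sub_norm M (phi \<gamma>) (\<xi> k)" for k
  define a where "a k t = coeff_fun f k t" for k t
  \<comment> \<open>Coefficients of the error \<open>Y = X - X\<^sub>N\<close> in terms of the \<open>\<xi>\<^sub>k\<close>.\<close>
  define b where "b k t = (if k \<le> N then a k t - ahat k t else a k t)" for k t
  define S where "S t = (\<Sum>k. ennreal ((\<tau> k)\<^sup>2 * (b k t)\<^sup>2))" for t
  define \<sigma> where "\<sigma> t = sqrt (enn2real (S t))" for t
  define Y where "Y t \<omega> = X t \<omega> - model \<xi> ahat N t \<omega>" for t \<omega>
  define C where "C = c_const M T p \<gamma> f \<xi> ahat N"

  have [measurable]: "\<xi> k \<in> borel_measurable M" for k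
    using xi_sub[of k] by (auto simp: Sub_def centered_def)
  have X_meas: "X t \<in> borel_measurable M" if "t \<in> {0..T}" for t
    using X_centered[OF that] by (auto simp: centered_def)
  \<comment> \<open>A Bochner integral that does not converge has the value \<open>0\<close>, so unit variance forces
    integrability.\<close>
  have \<xi>2: "integrable M (\<lambda>\<omega>. (\<xi> k \<omega>)\<^sup>2)" for k
  proof (rule ccontr)
    assume "\<not> integrable M (\<lambda>\<omega>. (\<xi> k \<omega>)\<^sup>2)"
    hence "(\<integral>\<omega>. \<xi> k \<omega> * \<xi> k \<omega> \<partial>M) = 0"
      by (simp add: power2_eq_square not_integrable_integral_eq)
    thus False
      using xi_orthonormal[of k k] by simp
  qed
  \<comment> \<open>Integrability is recorded because the mean square errors in the expansion are Bochner integrals,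
    which say nothing about a function that is not integrable.\<close>
  have residual2: "integrable M (\<lambda>\<omega>. (X t \<omega> - (\<Sum>k\<le>n. a k t * \<xi> k \<omega>))\<^sup>2)" if "t \<in> {0..T}" for t n
    by (rule integrable_square_diff_sum[OF X_meas[OF that] _ X_second_order[OF that] \<xi>2]) measurable
  have a_moment: "a k t = (\<integral>\<omega>. X t \<omega> * \<xi> k \<omega> \<partial>M)" if "t \<in> {0..T}" for k t
    using X_expansion[OF that] residual2[OF that] unfolding a_def
    by (intro orthonormal_coefficient_as_moment X_meas[OF that] X_second_order[OF that] \<xi>2 xi_orthonormal)
       measurable

  have a_meas [measurable]: "a k \<in> borel_measurable ?L" for k
  proof -
    have "(\<lambda>(t, \<omega>). X t \<omega> * \<xi> k \<omega>) \<in> borel_measurable (?L \<Otimes>\<^sub>M M)"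
      using X_measurable by (simp add: case_prod_unfold)
    hence "(\<lambda>t. \<integral>\<omega>. X t \<omega> * \<xi> k \<omega> \<partial>M) \<in> borel_measurable ?L"
      by (rule borel_measurable_lebesgue_integral)
    moreover have "a k \<in> borel_measurable ?L \<longleftrightarrow> (\<lambda>t. \<integral>\<omega>. X t \<omega> * \<xi> k \<omega> \<partial>M) \<in> borel_measurable ?L"
      by (rule measurable_cong) (simp add: a_moment)
    ultimately show ?thesis by simp
  qed
  have [measurable]: "b k \<in> borel_measurable ?L" for k
    unfolding b_def using ahat_measurable[of k] by (cases "k \<le> N") auto
  have [measurable]: "S \<in> borel_measurable ?L"
    unfolding S_def by measurable
  have \<sigma>_meas [measurable]: "\<sigma> \<in> borel_measurable ?L"
    unfolding \<sigma>_def by measurable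
  have Y_meas: "(\<lambda>(t, \<omega>). Y t \<omega>) \<in> borel_measurable (?L \<Otimes>\<^sub>M M)"
  proof -
    have "(\<lambda>z. X (fst z) (snd z)) \<in> borel_measurable (?L \<Otimes>\<^sub>M M)"
      using X_measurable by (simp only: case_prod_unfold)
    moreover have "(\<lambda>z. \<xi> k (snd z) * ahat k (fst z)) \<in> borel_measurable (?L \<Otimes>\<^sub>M M)" if "k \<le> N" for k
      using ahat_measurable[OF that] by measurable
    hence "(\<lambda>z. \<Sum>k\<le>N. \<xi> k (snd z) * ahat k (fst z)) \<in> borel_measurable (?L \<Otimes>\<^sub>M M)"
      by (rule borel_measurable_sum) simp
    ultimately show ?thesis
      unfolding Y_def model_def case_prod_unfold by (rule borel_measurable_diff)
  qed
  have L_sigma_finite: "sigma_finite_measure ?L"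
    by (intro finite_measure.axioms(1) finite_measure_lebesgue_on) simp

  \<comment> \<open>\<open>S\<close> is a measurable minorant of the bracket in the definition of \<open>c\<^sub>N\<close>. Passing to it matters
    because the bracket itself contains \<open>\<integral> Z\<^sub>f\<^sup>2\<close>, whose measurability in \<open>t\<close> is not known.\<close>
  have S_le: "S t \<le> (\<integral>\<^sup>+x. ennreal ((Z f t x)\<^sup>2) \<partial>lborel) *
           (\<Sum>j. let k = N + 1 + j in
              ennreal ((sub_norm M (phi \<gamma>) (\<xi> k))\<^sup>2 / ((real k)\<^sup>2 + 3 * real k + 2))) +
         ennreal (\<Sum>k\<le>N. (sub_norm M (phi \<gamma>) (\<xi> k))\<^sup>2 * \<bar>coeff_fun f k t - ahat k t\<bar>\<^sup>2)"
    if "t \<in> {0..T}" for t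
  proof -
    let ?I = "\<integral>\<^sup>+x. ennreal ((Z f t x)\<^sup>2) \<partial>lborel"
    let ?q = "\<lambda>k. (real k)\<^sup>2 + 3 * real k + 2"
    have tail_term: "ennreal ((\<tau> k)\<^sup>2 * (b k t)\<^sup>2) \<le> ?I * ennreal ((\<tau> k)\<^sup>2 / ?q k)" if "k > N" for k
    proof -
      have q: "?q k > 0"
        by (simp add: add_nonneg_pos)
      have "(\<tau> k)\<^sup>2 * (b k t)\<^sup>2 = ((a k t)\<^sup>2 * ?q k) * ((\<tau> k)\<^sup>2 / ?q k)"
        using q that by (simp add: b_def)
      hence "ennreal ((\<tau> k)\<^sup>2 * (b k t)\<^sup>2) = ennreal ((a k t)\<^sup>2 * ?q k) * ennreal ((\<tau> k)\<^sup>2 / ?q k)"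
        using q by (simp only: ennreal_mult'' divide_nonneg_pos zero_le_power2)
      also have "\<dots> \<le> ?I * ennreal ((\<tau> k)\<^sup>2 / ?q k)"
        unfolding a_def using \<open>t \<in> {0..T}\<close>
        by (intro mult_right_mono coeff_fun_square_bound f_diff f_diff2 f_bounded Z_integrable) auto
      finally show ?thesis .
    qed
    have "S t = (\<Sum>j. ennreal ((\<tau> (j + Suc N))\<^sup>2 * (b (j + Suc N) t)\<^sup>2)) +
            (\<Sum>k<Suc N. ennreal ((\<tau> k)\<^sup>2 * (b k t)\<^sup>2))"
      unfolding S_def by (rule suminf_offset) simp
    also have "\<dots> \<le> (\<Sum>j. ?I * ennreal ((\<tau> (j + Suc N))\<^sup>2 / ?q (j + Suc N))) +
            (\<Sum>k<Suc N. ennreal ((\<tau> k)\<^sup>2 * (b k t)\<^sup>2))"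
      by (intro add_right_mono suminf_le tail_term) auto
    also have "(\<Sum>j. ?I * ennreal ((\<tau> (j + Suc N))\<^sup>2 / ?q (j + Suc N))) =
            ?I * (\<Sum>j. let k = N + 1 + j in ennreal ((\<tau> k)\<^sup>2 / ?q k))"
      by (simp only: ennreal_suminf_cmult Let_def Suc_eq_plus1 add.commute[of _ "N + 1"])
    also have "(\<Sum>k<Suc N. ennreal ((\<tau> k)\<^sup>2 * (b k t)\<^sup>2)) =
            ennreal (\<Sum>k\<le>N. (\<tau> k)\<^sup>2 * \<bar>a k t - ahat k t\<bar>\<^sup>2)"
      by (simp add: lessThan_Suc_atMost b_def sum_ennreal)
    finally show ?thesis
      by (simp only: \<tau>_def a_def)
  qed
  have epowr_S: "(\<integral>\<^sup>+t. epowr (S t) (p / 2) \<partial>?L) \<le> C"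
    unfolding C_def c_const_def using \<open>p \<ge> 1\<close>
    by (intro nn_integral_mono epowr_mono S_le) auto
  hence S_moment: "(\<integral>\<^sup>+t. epowr (S t) (p / 2) \<partial>?L) < \<top>"
    using c_finite unfolding C_def by simp
  have \<sigma>_moment: "(\<integral>\<^sup>+t. ennreal (\<sigma> t powr p) \<partial>?L) \<le> C"
  proof -
    have "ennreal (\<sigma> t powr p) \<le> epowr (S t) (p / 2)" for t
      by (simp add: epowr_def \<sigma>_def powr_half_sqrt[symmetric] powr_powr)
    hence "(\<integral>\<^sup>+t. ennreal (\<sigma> t powr p) \<partial>?L) \<le> (\<integral>\<^sup>+t. epowr (S t) (p / 2) \<partial>?L)"
      by (intro nn_integral_mono)
    thus ?thesis
      using epowr_S by (rule order_trans)
  qed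
  have "AE t in ?L. epowr (S t) (p / 2) \<noteq> \<infinity>"
    using S_moment by (intro nn_integral_PInf_AE) (auto simp: less_top)
  hence S_finite: "AE t in ?L. S t < \<top>"
    by eventually_elim (auto simp: epowr_def top.not_eq_extremum[symmetric] split: if_splits)

  have mgf: "AE t in ?L. \<forall>u. (\<integral>\<^sup>+\<omega>. ennreal (exp (u * Y t \<omega>)) \<partial>M) \<le> ennreal (exp (phi \<gamma> (u * \<sigma> t)))"
    using S_finite AE_space
  proof eventually_elim
    case (elim t)
    hence t: "t \<in> {0..T}" by simp
    note [measurable] = X_meas[OF t]
    have Y_t [measurable]: "Y t \<in> borel_measurable M"
      unfolding Y_def model_def by measurable
    \<comment> \<open>The first \<open>N + 1\<close> corrections absorb the model, so the partial sums of \<open>Y\<close> leave the same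
      remainder as those of \<open>X\<close>.\<close>
    have residual: "Y t \<omega> - (\<Sum>k\<le>N + n. b k t * \<xi> k \<omega>) = X t \<omega> - (\<Sum>k\<le>N + n. a k t * \<xi> k \<omega>)" for n \<omega>
    proof -
      have "(\<Sum>k\<le>N + n. (a k t - b k t) * \<xi> k \<omega>) = (\<Sum>k\<le>N. (a k t - b k t) * \<xi> k \<omega>)"
        by (rule sum.mono_neutral_right) (auto simp: b_def)
      also have "\<dots> = model \<xi> ahat N t \<omega>"
        unfolding model_def by (rule sum.cong) (auto simp: b_def)
      finally show ?thesis
        by (simp add: Y_def left_diff_distrib sum_subtractf)
    qed
    have lim: "(\<lambda>n. \<integral>\<omega>. (Y t \<omega> - (\<Sum>k\<le>N + n. b k t * \<xi> k \<omega>))\<^sup>2 \<partial>M) \<longlonglongrightarrow> 0"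
      unfolding residual using LIMSEQ_ignore_initial_segment[OF X_expansion[OF t], of N]
      by (simp add: a_def add.commute)
    have int: "integrable M (\<lambda>\<omega>. (Y t \<omega> - (\<Sum>k\<le>N + n. b k t * \<xi> k \<omega>))\<^sup>2)" for n
      unfolding residual by (rule residual2[OF t])
    show ?case
      using mgf_le_of_expansion[OF \<open>prob_space M\<close> \<open>\<gamma> > 2\<close> xi_indep xi_sub Y_t int lim]
        elim(1) unfolding \<sigma>_def S_def \<tau>_def by blast
  qed

  let ?A = "{\<omega> \<in> space M. (\<integral>\<^sup>+t. ennreal (\<bar>Y t \<omega>\<bar> powr p) \<partial>?L) > ennreal \<delta>}"
  have A_meas: "?A \<in> sets M"
  proof -
    interpret L: sigma_finite_measure ?L by (rule L_sigma_finite)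
    have [measurable]: "(\<lambda>(\<omega>, t). Y t \<omega>) \<in> borel_measurable (M \<Otimes>\<^sub>M ?L)"
      using measurable_compose[OF measurable_pair_swap' Y_meas] by (simp add: case_prod_unfold)
    show ?thesis by measurable
  qed
  have "emeasure M ?A \<le> ennreal \<alpha>"
  proof (cases "(\<integral>\<^sup>+t. ennreal (\<sigma> t powr p) \<partial>?L) = 0")
    case True
    have "emeasure M ?A = 0"
      by (rule Lp_tail_degenerate[OF L_sigma_finite Y_meas \<sigma>_meas mgf phi_0 True])
    thus ?thesis by simp
  next
    case False
    define c where "c = enn2real (\<integral>\<^sup>+t. ennreal (\<sigma> t powr p) \<partial>?L)"
    have c: "(\<integral>\<^sup>+t. ennreal (\<sigma> t powr p) \<partial>?L) = ennreal c"
      using order_le_less_trans[OF \<sigma>_moment] c_finite by (simp add: c_def C_def)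
    hence "c > 0"
      using False by (auto simp: c ennreal_eq_0_iff not_le)
    have "ennreal c \<le> ennreal (\<delta> / (\<beta> * ln (2 / \<alpha>)) powr (p / \<beta>))"
      using \<sigma>_moment c_bound1 unfolding c C_def by (rule order_trans)
    hence c1: "c \<le> \<delta> / (\<beta> * ln (2 / \<alpha>)) powr (p / \<beta>)"
      using \<open>\<delta> > 0\<close> by (subst (asm) ennreal_le_iff) auto
    have "ennreal c < ennreal (\<delta> / p powr (p * (1 - 1 / \<gamma>)))"
      using \<sigma>_moment c_bound2 unfolding c C_def by (rule order_le_less_trans)
    hence c2: "c < \<delta> / p powr (p * (1 - 1 / \<gamma>))"
      using \<open>c > 0\<close> by (subst (asm) ennreal_less_iff) auto
    obtain x v where xv: "0 < x" "x powr p = \<delta> / c" "p \<le> v * x" "2 * exp (phi \<gamma> v - v * x) \<le> \<alpha>"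
      using optimal_exponent[OF assms(4,5,3) \<open>\<delta> > 0\<close> \<open>0 < \<alpha>\<close> \<open>\<alpha> < 1\<close> \<open>c > 0\<close> c1 c2] by blast
    have "emeasure M ?A \<le> ennreal (2 * exp (phi \<gamma> v - v * x))"
      using \<open>p \<ge> 1\<close>
      by (intro Lp_tail_bound[OF L_sigma_finite Y_meas \<sigma>_meas _ mgf phi_0 phi_minus c \<open>c > 0\<close> _ \<open>\<delta> > 0\<close> xv(1-3)])
         (auto simp: \<sigma>_def)
    also have "\<dots> \<le> ennreal \<alpha>"
      using xv(4) by (rule ennreal_leI)
    finally show ?thesis .
  qed
  hence "measure M ?A \<le> \<alpha>"
    using \<open>0 < \<alpha>\<close> by (simp add: emeasure_eq_measure)
  thus ?thesis
    using A_meas by (simp add: approximates_Lp_def Y_def)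
qed

end
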